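(* Let $b\ge2$ be an integer and let $\theta$ be an irrational number in $(0,1)$ with bounded partial quotients. Then $$\mathcal{L}(\theta)\subset\Big[\frac53+\frac{4\sqrt{10}}{15},\ 1+\mu(\xi_b(\theta))\Big],$$ and there exists an intercept $\rho(\theta)\in[0,1)$ such that $\mu(\xi_b(\theta,\rho(\theta)))=1+\mu(\xi_b(\theta))$.
   Context: For $\rho\in[0,1)$ and $n\ge1$ let $s_n=\lfloor n\theta+\rho\rfloor-\lfloor(n-1)\theta+\rho\rfloor$ and $s'_n=\lceil n\theta+\rho\rceil-\lceil(n-1)\theta+\rho\rceil$; the words $s_1s_2\cdots$ and $s'_1s'_2\cdots$ are the lower and upper Sturmian words of slope $\theta$ and intercept $\rho$. A Sturmian number of slope $\theta$ is a real number $\sum_{n\ge1}x_nb'^{-n}$, for some integer $b'\ge2$, whose $b'$-ary digit sequence is obtained from a lower or upper Sturmian word of slope $\theta$ by replacing $0,1$ by two distinct digits in $\{0,\dots,b'-1\}$. $\mathcal{L}(\theta)$ denotes the set of irrationality exponents of Sturmian numbers of slope $\theta$. Define $\xi_b(\theta,\rho)=(b-1)\sum_{n\ge1}s_nb^{-n}$ and $\xi_b(\theta)=(b-1)\sum_{j\ge1}b^{-\lfloor j/\theta\rfloor}$. The irrationality exponent $\mu(\zeta)$ of an irrational $\zeta$ is the supremum of the real $\mu$ such that $|\zeta-p/q|<q^{-\mu}$ has infinitely many rational solutions $p/q$. *)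

theory Defs
  imports Complex_Main "HOL-Library.Extended_Real"
begin

text \<open>Supremum taken in the extended reals, so that the value \<open>\<infinity>\<close> is allowed. The rational
  solutions are counted as numbers, not as pairs \<open>(p, q)\<close>.\<close>

definition irrationality_exponent :: "real \<Rightarrow> ereal" where
  "irrationality_exponent \<zeta> = Sup {ereal \<mu> | \<mu>.
     infinite {r :: real. \<exists>(p::int) (q::nat). q \<ge> 1 \<and> r = of_int p / real q \<and>
       \<bar>\<zeta> - of_int p / real q\<bar> < real q powr (- \<mu>)}}"

text \<open>Complete quotients of the continued fraction expansion
  \<open>\<theta> = [a\<^sub>0; a\<^sub>1, a\<^sub>2, \<dots>]\<close>; for irrational \<open>\<theta>\<close> no fractional part vanishes.\<close>

primrec complete_quotient :: "real \<Rightarrow> nat \<Rightarrow> real" where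
  "complete_quotient \<theta> 0 = \<theta>"
| "complete_quotient \<theta> (Suc n) = 1 / frac (complete_quotient \<theta> n)"

definition partial_quotient :: "real \<Rightarrow> nat \<Rightarrow> int" where
  "partial_quotient \<theta> n = \<lfloor>complete_quotient \<theta> n\<rfloor>"

definition bounded_partial_quotients :: "real \<Rightarrow> bool" where
  "bounded_partial_quotients \<theta> \<longleftrightarrow> (\<exists>M. \<forall>n. partial_quotient \<theta> n \<le> M)"

text \<open>Words are indexed from \<open>1\<close>; the value at index \<open>0\<close> is never used.\<close>

definition lower_sturmian :: "real \<Rightarrow> real \<Rightarrow> nat \<Rightarrow> int" where
  "lower_sturmian \<theta> \<rho> n = \<lfloor>real n * \<theta> + \<rho>\<rfloor> - \<lfloor>(real n - 1) * \<theta> + \<rho>\<rfloor>"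

definition upper_sturmian :: "real \<Rightarrow> real \<Rightarrow> nat \<Rightarrow> int" where
  "upper_sturmian \<theta> \<rho> n = \<lceil>real n * \<theta> + \<rho>\<rceil> - \<lceil>(real n - 1) * \<theta> + \<rho>\<rceil>"

definition is_sturmian_word :: "real \<Rightarrow> (nat \<Rightarrow> int) \<Rightarrow> bool" where
  "is_sturmian_word \<theta> s \<longleftrightarrow>
     (\<exists>\<rho>. 0 \<le> \<rho> \<and> \<rho> < 1 \<and> (s = lower_sturmian \<theta> \<rho> \<or> s = upper_sturmian \<theta> \<rho>))"

definition is_sturmian_number :: "real \<Rightarrow> real \<Rightarrow> bool" where
  "is_sturmian_number \<theta> \<zeta> \<longleftrightarrow>
     (\<exists>(b::nat) (d\<^sub>0::nat) (d\<^sub>1::nat) s. b \<ge> 2 \<and> d\<^sub>0 < b \<and> d\<^sub>1 < b \<and> d\<^sub>0 \<noteq> d\<^sub>1 \<and>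
        is_sturmian_word \<theta> s \<and>
        \<zeta> = (\<Sum>n. real (if s (Suc n) = 0 then d\<^sub>0 else d\<^sub>1) / real b ^ Suc n))"

definition sturmian_exponents :: "real \<Rightarrow> ereal set" where
  "sturmian_exponents \<theta> = {irrationality_exponent \<zeta> | \<zeta>. is_sturmian_number \<theta> \<zeta>}"

definition xi_intercept :: "nat \<Rightarrow> real \<Rightarrow> real \<Rightarrow> real" where
  "xi_intercept b \<theta> \<rho> =
     (real b - 1) * (\<Sum>n. of_int (lower_sturmian \<theta> \<rho> (Suc n)) / real b ^ Suc n)"

definition xi :: "nat \<Rightarrow> real \<Rightarrow> real" where
  "xi b \<theta> = (real b - 1) * (\<Sum>j. real b powi (- \<lfloor>real (Suc j) / \<theta>\<rfloor>))"

end

theory Submission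
  imports Defs
begin

text \<open>
  A repetition \<open>x\<^sub>u\<^sub>+\<^sub>1\<dots>x\<^sub>u\<^sub>+\<^sub>N = x\<^sub>u\<^sub>+\<^sub>v\<^sub>+\<^sub>1\<dots>x\<^sub>u\<^sub>+\<^sub>v\<^sub>+\<^sub>N\<close> in a Sturmian word yields an approximation of the
  Sturmian number with denominator about \<open>b\<^bsup>u+v\<^esup>\<close> and error about \<open>b\<^bsup>-(u+v+N)\<^esup>\<close>. As the word has only
  \<open>n + 1\<close> factors of length \<open>n\<close>, such approximations occur at every scale with the quality of Dirichlet's
  theorem, so that they determine the exponent.

  Let \<open>q\<^sub>m\<close> be the denominators of the convergents of \<open>\<theta>\<close> and \<open>K = limsup q\<^sub>m\<^sub>+\<^sub>1 / q\<^sub>m\<close>. A repetition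
  with period \<open>v\<close>, \<open>q\<^sub>m \<le> v < q\<^sub>m\<^sub>+\<^sub>1\<close>, has length at most \<open>q\<^sub>m + q\<^sub>m\<^sub>+\<^sub>1\<close>, because every arc of length
  \<open>\<parallel>q\<^sub>m\<theta>\<parallel>\<close> is visited within that time; hence the exponent is at most \<open>2 + K\<close>. For \<open>\<xi>\<^sub>b(\<theta>)\<close>, whose word
  has intercept \<open>\<theta>\<close>, the prefix of period \<open>q\<^sub>m\<close> breaks exactly at \<open>q\<^sub>m\<^sub>+\<^sub>1 - 1\<close>, and the exponent is
  \<open>1 + K\<close>. Nested intervals give an intercept for which infinitely many, nearly extremal, periods
  \<open>q\<^sub>m\<close> persist for a time close to \<open>q\<^sub>m + q\<^sub>m\<^sub>+\<^sub>1\<close>.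

  For the lower bound let \<open>T\<^sub>m\<close> be the first time at which the period \<open>q\<^sub>m\<close> breaks. If the exponent were
  smaller, the repetitions with periods \<open>q\<^sub>m\<close> and \<open>q\<^sub>m + q\<^sub>m\<^sub>+\<^sub>1\<close> would eventually force
  \<open>T\<^sub>m\<^sub>+\<^sub>1 = T\<^sub>m + q\<^sub>m\<close> and linear inequalities between \<open>T\<^sub>m\<close> and \<open>q\<^sub>m\<close> that only the partial quotients
  \<open>2, 1, 1, 2, 1, 1, \<dots>\<close> come close to satisfying, and these violate them in the limit.
\<close>

section \<open>Convergents of the slope\<close>

locale irrational_slope =
  fixes \<theta> :: real
  assumes slope_pos: "0 < \<theta>" and slope_less_1: "\<theta> < 1" and slope_irrational: "\<theta> \<notin> \<rat>"
begin

text \<open>Indices are shifted by one against the usual convention: \<open>cf_denom m\<close>, \<open>cf_num m\<close> are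
  \<open>q\<^sub>m\<^sub>-\<^sub>1\<close>, \<open>p\<^sub>m\<^sub>-\<^sub>1\<close>, and \<open>cf_digit m\<close> is the partial quotient \<open>a\<^sub>m\<^sub>+\<^sub>1\<close>.\<close>

fun cf_error :: "nat \<Rightarrow> real" where
  "cf_error 0 = 1"
| "cf_error (Suc 0) = \<theta>"
| "cf_error (Suc (Suc m)) =
     cf_error m - of_int \<lfloor>cf_error m / cf_error (Suc m)\<rfloor> * cf_error (Suc m)"

definition cf_digit :: "nat \<Rightarrow> nat" where
  "cf_digit m = nat \<lfloor>cf_error m / cf_error (Suc m)\<rfloor>"

fun cf_denom :: "nat \<Rightarrow> nat" where
  "cf_denom 0 = 0"
| "cf_denom (Suc 0) = 1"
| "cf_denom (Suc (Suc m)) = cf_denom m + cf_digit m * cf_denom (Suc m)"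

fun cf_num :: "nat \<Rightarrow> int" where
  "cf_num 0 = 1"
| "cf_num (Suc 0) = 0"
| "cf_num (Suc (Suc m)) = cf_num m + int (cf_digit m) * cf_num (Suc m)"

definition cf_offset :: "nat \<Rightarrow> real" where
  "cf_offset m = real (cf_denom m) * \<theta> - of_int (cf_num m)"

lemma multiple_slope_not_int: "0 < k \<Longrightarrow> real k * \<theta> \<noteq> of_int l"
proof
  assume "0 < k" "real k * \<theta> = of_int l"
  then have "\<theta> = of_int l / of_int (int k)" by (simp add: field_simps)
  then have "\<theta> \<in> \<rat>" by (metis Rats_divide Rats_of_int)
  then show False using slope_irrational by simp
qed

text \<open>All five facts share one induction: decreasing errors make the next digit positive,
  positive digits keep the denominators positive, and the signed formula for the offsets turns
  irrationality into a nonzero remainder, so the Euclidean algorithm never stops.\<close>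

lemma cf_error_decreasing:
  "0 < cf_error (Suc m) \<and> cf_error (Suc m) < cf_error m
   \<and> 0 < cf_denom (Suc m)
   \<and> cf_offset m = - ((-1) ^ m) * cf_error m
   \<and> cf_offset (Suc m) = (-1) ^ m * cf_error (Suc m)"
proof (induction m)
  case 0
  then show ?case using slope_pos slope_less_1 by (simp add: cf_offset_def)
next
  case (Suc m)
  define r where "r = cf_error m / cf_error (Suc m)"
  have r1: "1 < r" using Suc by (simp add: r_def)
  then have fl: "1 \<le> \<lfloor>r\<rfloor>" by linarith
  then have dig: "real (cf_digit m) = of_int \<lfloor>r\<rfloor>"
    by (simp add: cf_digit_def r_def)
  have off: "cf_offset (Suc (Suc m)) = cf_offset m + real (cf_digit m) * cf_offset (Suc m)"
    by (simp add: cf_offset_def algebra_simps)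
  have err: "cf_error (Suc (Suc m)) = cf_error m - real (cf_digit m) * cf_error (Suc m)"
    by (simp add: dig r_def)
  have off2: "cf_offset (Suc (Suc m)) = (-1) ^ Suc m * cf_error (Suc (Suc m))"
    unfolding off err using Suc by (simp add: algebra_simps)
  have pos: "0 < cf_denom (Suc (Suc m))"
    using Suc fl dig by (simp add: cf_digit_def r_def)
  have "cf_offset (Suc (Suc m)) \<noteq> 0"
    using multiple_slope_not_int[OF pos] unfolding cf_offset_def by (simp del: cf_denom.simps cf_num.simps)
  then have nz: "cf_error (Suc (Suc m)) \<noteq> 0" using off2 by auto
  have fr: "cf_error (Suc (Suc m)) = (r - of_int \<lfloor>r\<rfloor>) * cf_error (Suc m)"
    unfolding err dig using Suc by (simp add: r_def field_simps)
  have "0 \<le> cf_error (Suc (Suc m))" unfolding fr using Suc by simp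
  moreover have "cf_error (Suc (Suc m)) < cf_error (Suc m)"
  proof -
    have "(r - of_int \<lfloor>r\<rfloor>) * cf_error (Suc m) < 1 * cf_error (Suc m)"
      using Suc by (intro mult_strict_right_mono) linarith+
    then show ?thesis unfolding fr by simp
  qed
  ultimately show ?case using nz pos off2 Suc by simp
qed

lemma cf_error_pos: "0 < cf_error m"
  using cf_error_decreasing[of m] by simp

lemma cf_error_Suc_less: "cf_error (Suc m) < cf_error m"
  using cf_error_decreasing[of m] by simp

text \<open>Errors decrease, so only the first sum matters, where \<open>1 / \<theta>\<close> has
  floor at least 1. The bound keeps two crossings in opposite directions within one turn of the
  circle.\<close>

lemma cf_error_add_le_1: "cf_error (Suc m) + cf_error (Suc (Suc m)) \<le> 1"
proof (induction m)
  case 0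
  have "1 \<le> 1 / \<theta>" using slope_pos slope_less_1 by simp
  then have "1 \<le> \<lfloor>1 / \<theta>\<rfloor>" by linarith
  then have "1 * \<theta> \<le> of_int \<lfloor>1 / \<theta>\<rfloor> * \<theta>" using slope_pos by (intro mult_right_mono) auto
  then show ?case by simp
next
  case (Suc m)
  then show ?case using cf_error_Suc_less[of "Suc m"] cf_error_Suc_less[of "Suc (Suc m)"] by linarith
qed

lemma cf_denom_pos: "0 < m \<Longrightarrow> 0 < cf_denom m"
  using cf_error_decreasing[of "m - 1"] by (cases m) auto

lemma cf_offset_eq: "cf_offset m = - ((-1) ^ m) * cf_error m"
  using cf_error_decreasing[of m] by simp

lemma abs_cf_offset: "\<bar>cf_offset m\<bar> = cf_error m"
  using cf_error_pos[of m] by (simp add: cf_offset_eq abs_mult)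

lemma cf_error_le_1: "cf_error m \<le> 1"
proof (induction m)
  case (Suc m) then show ?case using cf_error_Suc_less[of m] by linarith
qed simp

lemma cf_digit_pos: "0 < cf_digit m"
proof -
  have "1 < cf_error m / cf_error (Suc m)" using cf_error_pos cf_error_Suc_less by simp
  then have "1 \<le> \<lfloor>cf_error m / cf_error (Suc m)\<rfloor>" by linarith
  then show ?thesis by (simp add: cf_digit_def)
qed

lemma cf_offset_Suc_Suc:
  "cf_offset (Suc (Suc m)) = cf_offset m + real (cf_digit m) * cf_offset (Suc m)"
  by (simp add: cf_offset_def algebra_simps)

text \<open>Offsets alternate in sign. Later arguments about crossing a jump of the coding split by
  direction, and the two cases mirror each other.\<close>

lemma cf_offset_cases:
  obtains (pos) "0 < cf_offset m" "cf_offset (Suc m) < 0" "cf_offset (Suc (Suc m)) > 0"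
    "cf_offset m = cf_error m" "cf_offset (Suc m) = - cf_error (Suc m)"
    "cf_offset (Suc (Suc m)) = cf_error (Suc (Suc m))"
  | (neg) "cf_offset m < 0" "0 < cf_offset (Suc m)" "cf_offset (Suc (Suc m)) < 0"
    "cf_offset m = - cf_error m" "cf_offset (Suc m) = cf_error (Suc m)"
    "cf_offset (Suc (Suc m)) = - cf_error (Suc (Suc m))"
  using cf_error_pos[of m] cf_error_pos[of "Suc m"] cf_error_pos[of "Suc (Suc m)"]
    cf_offset_eq[of m] cf_offset_eq[of "Suc m"] cf_offset_eq[of "Suc (Suc m)"]
  by (cases "even m") auto

lemma cf_denom_le_Suc: "cf_denom m \<le> cf_denom (Suc m)"
proof (cases m)
  case (Suc k)
  have "1 * cf_denom (Suc k) \<le> cf_digit k * cf_denom (Suc k)"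
    using cf_digit_pos[of k] by (intro mult_right_mono) auto
  then show ?thesis unfolding Suc cf_denom.simps by linarith
qed simp

lemma cf_denom_less_Suc: "cf_denom (Suc (Suc m)) < cf_denom (Suc (Suc (Suc m)))"
proof -
  have "0 < cf_denom (Suc m)" by (rule cf_denom_pos) simp
  moreover have "cf_denom (Suc (Suc m)) \<le> cf_digit (Suc m) * cf_denom (Suc (Suc m))"
    using cf_digit_pos[of "Suc m"] by simp
  ultimately show ?thesis by (simp only: cf_denom.simps(3)[of "Suc m"])
qed

lemma cf_denom_mono: "m \<le> n \<Longrightarrow> cf_denom m \<le> cf_denom n"
  using cf_denom_le_Suc by (rule lift_Suc_mono_le)

text \<open>Crude linear growth, enough to make denominators large with their index. The
  \<open>Suc\<close> allows for \<open>cf_denom 1 = cf_denom 2\<close>, which happens when the first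
  digit is 1.\<close>

lemma cf_denom_ge: "m \<le> Suc (cf_denom m)"
proof (induction m)
  case (Suc m)
  show ?case
  proof (cases "m \<ge> 2")
    case True
    then obtain k where "m = Suc (Suc k)" by (metis add_2_eq_Suc le_Suc_ex)
    then show ?thesis using Suc cf_denom_less_Suc[of k] by (metis Suc_leI le_trans not_less_eq_eq)
  next
    case False
    then have "m = 0 \<or> m = 1" by linarith
    moreover have "0 < cf_denom 2" by (rule cf_denom_pos) simp
    ultimately show ?thesis by (auto simp: numeral_2_eq_2)
  qed
qed simp

lemma cf_determinant:
  "int (cf_denom (Suc m)) * cf_num m - int (cf_denom m) * cf_num (Suc m) = (-1) ^ m"
proof (induction m)
  case (Suc m)
  have "int (cf_denom (Suc (Suc m))) * cf_num (Suc m) - int (cf_denom (Suc m)) * cf_num (Suc (Suc m))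
    = - (int (cf_denom (Suc m)) * cf_num m - int (cf_denom m) * cf_num (Suc m))"
    by (simp add: algebra_simps)
  then show ?case using Suc by simp
qed simp

text \<open>The determinant identity amounts to \<open>cf_denom m * cf_error (Suc m) + cf_denom (Suc
  m) * cf_error m = 1\<close>, with both summands nonnegative.\<close>

lemma cf_error_denom: "cf_error m * real (cf_denom (Suc m)) \<le> 1"
proof -
  have "real_of_int (int (cf_denom (Suc m)) * cf_num m - int (cf_denom m) * cf_num (Suc m)) = (-1) ^ m"
    by (simp only: cf_determinant of_int_power of_int_minus of_int_1)
  then have "cf_denom m * cf_offset (Suc m) - cf_denom (Suc m) * cf_offset m = (-1) ^ m"
    by (simp add: cf_offset_def algebra_simps)
  then have "(-1) ^ m * (cf_denom m * cf_error (Suc m) + cf_denom (Suc m) * cf_error m) = (-1) ^ m"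
    by (simp add: cf_offset_eq algebra_simps)
  then have "cf_denom m * cf_error (Suc m) + cf_denom (Suc m) * cf_error m = 1" by simp
  moreover have "0 \<le> cf_denom m * cf_error (Suc m)" using cf_error_pos[of "Suc m"] by simp
  ultimately show ?thesis by (simp add: mult.commute)
qed

text \<open>Determinant 1 or -1 makes two consecutive convergents a basis of the integer lattice. As
  \<open>k\<close> is below the larger denominator, the first coordinate is nonzero and the two
  coordinates cannot have the same sign; the offsets alternate in sign, so the two contributions add
  up instead of cancelling.\<close>

lemma best_approximation:
  assumes "0 < k" "k < cf_denom (Suc m)"
  shows "cf_error m \<le> \<bar>real k * \<theta> - of_int l\<bar>"
proof -
  define s where "s = (-1 :: int) ^ m"
  \<comment> \<open>Coordinates of the pair \<open>(k, l)\<close> in the basis of the two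
    convergents, by Cramer's rule.\<close>
  define x where "x = s * (l * int (cf_denom (Suc m)) - int k * cf_num (Suc m))"
  define y where "y = s * (int k * cf_num m - l * int (cf_denom m))"
  have s1: "s * s = 1" by (simp add: s_def flip: power_mult_distrib)
  have "x * int (cf_denom m) + y * int (cf_denom (Suc m))
     = s * int k * (int (cf_denom (Suc m)) * cf_num m - int (cf_denom m) * cf_num (Suc m))"
    by (simp add: x_def y_def algebra_simps)
  also have "\<dots> = int k" using s1 by (simp add: cf_determinant flip: s_def)
  finally have k: "x * int (cf_denom m) + y * int (cf_denom (Suc m)) = int k" .
  have "x * cf_num m + y * cf_num (Suc m)
     = s * l * (int (cf_denom (Suc m)) * cf_num m - int (cf_denom m) * cf_num (Suc m))"
    by (simp add: x_def y_def algebra_simps)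
  also have "\<dots> = l" using s1 by (simp add: cf_determinant flip: s_def)
  finally have l: "x * cf_num m + y * cf_num (Suc m) = l" .
  have "real k * \<theta> - of_int l = real_of_int x * cf_offset m + real_of_int y * cf_offset (Suc m)"
  proof -
    have "real k = real_of_int x * cf_denom m + real_of_int y * cf_denom (Suc m)"
      using arg_cong[OF k, of real_of_int] by simp
    moreover have "real_of_int l = x * cf_num m + y * cf_num (Suc m)"
      using arg_cong[OF l, of real_of_int] by simp
    ultimately show ?thesis by (simp add: cf_offset_def algebra_simps)
  qed
  also have "\<bar>\<dots>\<bar> = \<bar>x * cf_error m - y * cf_error (Suc m)\<bar>"
    by (simp add: cf_offset_eq flip: abs_minus_commute) (cases "even m"; simp)
  finally have eq: "\<bar>real k * \<theta> - of_int l\<bar> = \<bar>x * cf_error m - y * cf_error (Suc m)\<bar>" .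
  have x0: "x \<noteq> 0"
  proof
    assume "x = 0"
    then have "y * int (cf_denom (Suc m)) = int k" using k by simp
    moreover from this have "0 < y" using assms by (metis mult_le_0_iff not_le of_nat_0_le_iff of_nat_0_less_iff)
    ultimately have "int (cf_denom (Suc m)) \<le> int k"
      by (metis int_one_le_iff_zero_less mult_1 mult_right_mono of_nat_0_le_iff)
    then show False using assms by simp
  qed
  have pos: "0 < cf_error m" "0 < cf_error (Suc m)" by (auto intro: cf_error_pos)
  consider "0 < x" "y \<le> 0" | "x < 0" "0 \<le> y"
  proof -
    have False if "0 < x" "0 < y"
    proof -
      have "0 \<le> x * int (cf_denom m)" using that by simp
      moreover have "1 * int (cf_denom (Suc m)) \<le> y * int (cf_denom (Suc m))"
        using that by (intro mult_right_mono) auto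
      ultimately show False using k assms by linarith
    qed
    moreover have False if "x < 0" "y < 0"
    proof -
      have "x * int (cf_denom m) \<le> 0" "y * int (cf_denom (Suc m)) \<le> 0"
        using that by (simp_all add: mult_nonpos_nonneg)
      then show False using k assms by linarith
    qed
    ultimately show thesis using that x0 by (meson linorder_neqE_linordered_idom not_le)
  qed
  then show ?thesis
  proof cases
    case 1
    then have "1 * cf_error m \<le> x * cf_error m" "y * cf_error (Suc m) \<le> 0"
      using pos by (auto intro!: mult_right_mono simp: mult_le_0_iff)
    then show ?thesis unfolding eq by linarith
  next
    case 2
    then have "x * cf_error m \<le> (-1) * cf_error m" "0 \<le> y * cf_error (Suc m)"
      using pos by (intro mult_right_mono, auto)
    then show ?thesis unfolding eq by linarith
  qed
qed

lemma ex_cf_denom_bracket: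
  assumes "1 \<le> v"
  obtains m where "1 \<le> m" "cf_denom m \<le> v" "v < cf_denom (Suc m)"
proof -
  define m where "m = (LEAST m. v < cf_denom (Suc m))"
  have "v < cf_denom (Suc (Suc v))" using cf_denom_ge[of "Suc (Suc (Suc v))"] cf_denom_less_Suc[of v] cf_denom_ge[of "Suc (Suc v)"]
    by (cases v) (use cf_denom_pos[of 2] in \<open>simp_all add: numeral_2_eq_2\<close>)
  then have m: "v < cf_denom (Suc m)" unfolding m_def by (rule LeastI[of "\<lambda>m. v < cf_denom (Suc m)"])
  then have "m \<noteq> 0" using assms by (intro notI) simp
  then obtain k where k: "m = Suc k" using not0_implies_Suc by blast
  then have "\<not> v < cf_denom (Suc k)" unfolding m_def by (intro not_less_Least) simp
  then show thesis using that[of m] m k by simp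
qed

end

section \<open>Times at which a period breaks\<close>

text \<open>The instances are \<open>floor\<close> and \<open>ceiling\<close>, for lower and upper Sturmian words.\<close>

locale sturmian_coding = irrational_slope +
  fixes g :: "real \<Rightarrow> int"
  assumes mono_g: "mono g" and g_add_1: "g (y + 1) = g y + 1"
begin

lemma g_mono: "y \<le> z \<Longrightarrow> g y \<le> g z"
  using mono_g by (rule monoD)

lemma g_add_nat: "g (y + real k) = g y + int k"
proof (induction k)
  case (Suc k)
  then show ?case using g_add_1[of "y + real k"] by (simp add: algebra_simps)
qed simp

lemma g_add_int: "g (y + of_int k) = g y + k"
proof (cases "k \<ge> 0")
  case True
  then show ?thesis using g_add_nat[of y "nat k"] by simp
next
  case False
  then show ?thesis using g_add_nat[of "y + of_int k" "nat (- k)"] by simp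
qed

lemma g_le_add: "z \<le> y + 1 \<Longrightarrow> g z \<le> g y + 1"
  using g_mono[of z "y + 1"] by (simp add: g_add_1)

definition level :: "real \<Rightarrow> nat \<Rightarrow> int" where
  "level \<rho> n = g (real n * \<theta> + \<rho>)"

text \<open>On the circle, \<open>hit \<rho> m n\<close> says that \<open>n\<theta> + \<rho>\<close> lies in the half-open arc between
  \<open>- cf_offset m\<close> and \<open>0\<close>; these are the times at which the period \<open>cf_denom m\<close> of the word breaks.\<close>

definition hit :: "real \<Rightarrow> nat \<Rightarrow> nat \<Rightarrow> bool" where
  "hit \<rho> m n \<longleftrightarrow> level \<rho> (n + cf_denom m) \<noteq> level \<rho> n + cf_num m"

lemma level_add: "level \<rho> (k + n) = level (real k * \<theta> + \<rho>) n"
  by (simp add: level_def algebra_simps)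

lemma hit_add: "hit \<rho> m (k + n) = hit (real k * \<theta> + \<rho>) m n"
  unfolding hit_def add.assoc level_add ..

lemma level_cf_denom:
  "level \<rho> (n + cf_denom m) = g (real n * \<theta> + \<rho> + cf_offset m) + cf_num m"
proof -
  have "real (n + cf_denom m) * \<theta> + \<rho> = real n * \<theta> + \<rho> + cf_offset m + of_int (cf_num m)"
    by (simp add: cf_offset_def algebra_simps)
  then show ?thesis unfolding level_def by (simp only: g_add_int)
qed

lemma hit_iff: "hit \<rho> m n \<longleftrightarrow> g (real n * \<theta> + \<rho> + cf_offset m) \<noteq> g (real n * \<theta> + \<rho>)"
  by (simp add: hit_def level_cf_denom) (simp add: level_def)

lemma hit_add_denom_iff:
  "hit \<rho> m (n + cf_denom k) \<longleftrightarrow>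
     g (real n * \<theta> + \<rho> + cf_offset k + cf_offset m) \<noteq> g (real n * \<theta> + \<rho> + cf_offset k)"
proof -
  have eq: "real (n + cf_denom k) * \<theta> + \<rho> = real n * \<theta> + \<rho> + cf_offset k + of_int (cf_num k)"
    by (simp add: cf_offset_def algebra_simps)
  have "real n * \<theta> + \<rho> + cf_offset k + of_int (cf_num k) + cf_offset m
      = real n * \<theta> + \<rho> + cf_offset k + cf_offset m + of_int (cf_num k)" by simp
  then show ?thesis unfolding hit_iff eq by (simp only: g_add_int) simp
qed

text \<open>Translate \<open>z\<close> by an integer so that both steps of length \<open>e\<close>
  start at the same value of \<open>g\<close>. Each start then lies before the end of the other
  step, by monotonicity. The strict bound is what contradicts \<open>best_approximation\<close>
  later.\<close>

lemma jumps_close: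
  assumes "g (y + e) \<noteq> g y" "g (z + e) \<noteq> g z"
  shows "\<exists>l::int. \<bar>z - y - of_int l\<bar> < \<bar>e\<bar>"
proof -
  define l where "l = g z - g y"
  define w where "w = z - of_int l"
  have z: "z = w + of_int l" "z + e = w + e + of_int l" by (simp_all add: w_def)
  have w: "g w = g y" using g_add_int[of w l] unfolding z(1)[symmetric] by (simp add: l_def)
  have we: "g (w + e) = g (z + e) - l" unfolding z(2) g_add_int by simp
  have "\<bar>w - y\<bar> < \<bar>e\<bar>"
  proof (cases "e > 0")
    case True
    have "g y \<le> g (y + e)" "g z \<le> g (z + e)" using True by (auto intro: g_mono)
    then have "g w < g (y + e)" "g y < g (w + e)" using assms w we by (auto simp: l_def)
    then have "w < y + e" "y < w + e" using g_mono by (meson not_le)+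
    then show ?thesis using True by linarith
  next
    case False
    have "g (y + e) \<le> g y" "g (z + e) \<le> g z" using False by (auto intro: g_mono)
    then have "g (y + e) < g w" "g (w + e) < g y" using assms w we by (auto simp: l_def)
    then have "y + e < w" "w + e < y" using g_mono by (meson not_le)+
    then show ?thesis using False by linarith
  qed
  then show ?thesis by (auto simp: w_def algebra_simps intro!: exI[of _ l])
qed

text \<open>Two visits to the same arc \<open>k\<close> steps apart bring
  \<open>k * \<theta>\<close> closer to an integer than \<open>cf_error m\<close>, which
  \<open>best_approximation\<close> forbids for small \<open>k\<close>.\<close>

lemma hit_gap:
  assumes "hit \<rho> m n" "hit \<rho> m (n + k)" "0 < k"
  shows "cf_denom (Suc m) \<le> k"
proof (rule ccontr)
  assume *: "\<not> ?thesis"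
  obtain l :: int where "\<bar>(real (n + k) * \<theta> + \<rho>) - (real n * \<theta> + \<rho>) - of_int l\<bar> < \<bar>cf_offset m\<bar>"
    using jumps_close assms(1,2) unfolding hit_iff by metis
  then have "\<bar>real k * \<theta> - of_int l\<bar> < cf_error m" by (simp add: abs_cf_offset algebra_simps)
  then show False using best_approximation[of k m l] assms * by simp
qed

text \<open>The step \<open>cf_offset (Suc m)\<close> crosses the jump; from its end the longer and
  opposite step \<open>cf_offset m\<close> crosses it back.\<close>

lemma hit_Suc_imp_hit:
  assumes "hit \<rho> (Suc m) n" shows "hit \<rho> m (n + cf_denom (Suc m))"
proof -
  let ?y = "real n * \<theta> + \<rho>"
  have j: "g (?y + cf_offset (Suc m)) \<noteq> g ?y" using assms by (simp add: hit_iff)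
  have less: "cf_error (Suc m) < cf_error m" by (rule cf_error_Suc_less)
  have "g (?y + cf_offset (Suc m) + cf_offset m) \<noteq> g (?y + cf_offset (Suc m))"
  proof (cases rule: cf_offset_cases[of m])
    case pos
    have "g (?y + cf_offset (Suc m)) \<le> g ?y" "g ?y \<le> g (?y + cf_offset (Suc m) + cf_offset m)"
      using pos less by (auto intro!: g_mono)
    then show ?thesis using j by linarith
  next
    case neg
    have "g ?y \<le> g (?y + cf_offset (Suc m))" "g (?y + cf_offset (Suc m) + cf_offset m) \<le> g ?y"
      using neg less by (auto intro!: g_mono)
    then show ?thesis using j by linarith
  qed
  then show ?thesis by (simp add: hit_add_denom_iff)
qed

text \<open>The two steps have the same direction and the one of index \<open>m\<close> is longer,
  so it crosses every jump that the other crosses.\<close>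

lemma hit_Suc_Suc_imp_hit:
  assumes "hit \<rho> (Suc (Suc m)) n" shows "hit \<rho> m n"
proof -
  let ?y = "real n * \<theta> + \<rho>"
  have j: "g (?y + cf_offset (Suc (Suc m))) \<noteq> g ?y" using assms unfolding hit_iff .
  have less: "cf_error (Suc (Suc m)) < cf_error m"
    using cf_error_Suc_less[of m] cf_error_Suc_less[of "Suc m"] by linarith
  have "g (?y + cf_offset m) \<noteq> g ?y"
  proof (cases rule: cf_offset_cases[of m])
    case pos
    have "g ?y \<le> g (?y + cf_offset (Suc (Suc m)))"
      "g (?y + cf_offset (Suc (Suc m))) \<le> g (?y + cf_offset m)"
      by (rule g_mono; use pos less in linarith)+
    then show ?thesis using j by linarith
  next
    case neg
    have "g (?y + cf_offset (Suc (Suc m))) \<le> g ?y"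
      "g (?y + cf_offset m) \<le> g (?y + cf_offset (Suc (Suc m)))"
      by (rule g_mono; use neg less in linarith)+
    then show ?thesis using j by linarith
  qed
  then show ?thesis by (simp add: hit_iff)
qed

text \<open>The steps point in opposite directions, so two crossings would make \<open>g\<close>
  change by at least 2 over a stretch of length at most 1.\<close>

lemma not_hit_both:
  assumes "hit \<rho> (Suc m) n" "hit \<rho> (Suc (Suc m)) n" shows False
proof -
  let ?y = "real n * \<theta> + \<rho>"
  have j: "g (?y + cf_offset (Suc m)) \<noteq> g ?y" "g (?y + cf_offset (Suc (Suc m))) \<noteq> g ?y"
    using assms unfolding hit_iff by blast+
  have le: "cf_error (Suc m) + cf_error (Suc (Suc m)) \<le> 1" by (rule cf_error_add_le_1)
  show False
  proof (cases rule: cf_offset_cases[of "Suc m"])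
    case pos
    have "g (?y + cf_offset (Suc (Suc m))) \<le> g ?y" "g ?y \<le> g (?y + cf_offset (Suc m))"
      by (rule g_mono; use pos in linarith)+
    moreover have "g (?y + cf_offset (Suc m)) \<le> g (?y + cf_offset (Suc (Suc m))) + 1"
      by (rule g_le_add) (use pos le in linarith)
    ultimately show False using j by linarith
  next
    case neg
    have "g ?y \<le> g (?y + cf_offset (Suc (Suc m)))" "g (?y + cf_offset (Suc m)) \<le> g ?y"
      by (rule g_mono; use neg in linarith)+
    moreover have "g (?y + cf_offset (Suc (Suc m))) \<le> g (?y + cf_offset (Suc m)) + 1"
      by (rule g_le_add) (use neg le in linarith)
    ultimately show False using j by linarith
  qed
qed

text \<open>After the crossing by \<open>cf_offset m\<close>, walk back in steps of
  \<open>cf_offset (Suc m)\<close>; \<open>c\<close> counts the steps before the jump is crossed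
  again. One step beyond \<open>cf_digit m\<close> certainly lies on the far side of the start. If
  \<open>c\<close> reaches \<open>cf_digit m\<close>, the walk stands at the endpoint of
  \<open>cf_offset (Suc (Suc m))\<close> without having recrossed, which is a hit of that
  index.\<close>

lemma hit_next:
  assumes "hit \<rho> m n"
  obtains c where "c \<le> cf_digit m"
    "hit \<rho> (Suc m) (n + c * cf_denom (Suc m) + cf_denom m)"
    "c = cf_digit m \<longrightarrow> hit \<rho> (Suc (Suc m)) n"
proof -
  define y where "y = real n * \<theta> + \<rho>"
  define z where "z j = y + cf_offset m + real j * cf_offset (Suc m)" for j
  have j0: "g (z 0) \<noteq> g y" using assms by (simp add: hit_iff y_def z_def)
  have zS: "z (Suc j) = z j + cf_offset (Suc m)" for j by (simp add: z_def algebra_simps)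
  have za: "z (cf_digit m) = y + cf_offset (Suc (Suc m))"
    by (simp only: z_def cf_offset_Suc_Suc)
  have cross: "g (z (Suc (cf_digit m))) \<noteq> g (z 0)"
  proof
    assume e: "g (z (Suc (cf_digit m))) = g (z 0)"
    have eq: "z (Suc (cf_digit m)) = y + cf_offset (Suc (Suc m)) + cf_offset (Suc m)"
      by (simp only: zS za)
    have z0: "z 0 = y + cf_offset m" by (simp add: z_def)
    have less: "cf_error (Suc (Suc m)) < cf_error (Suc m)" by (rule cf_error_Suc_less)
    show False
    proof (cases rule: cf_offset_cases[of m])
      case pos
      have "g (z (Suc (cf_digit m))) \<le> g y" "g y \<le> g (z 0)"
        by (rule g_mono; use pos less eq z0 in linarith)+
      then show False using e j0 by linarith
    next
      case neg
      have "g y \<le> g (z (Suc (cf_digit m)))" "g (z 0) \<le> g y"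
        by (rule g_mono; use neg less eq z0 in linarith)+
      then show False using e j0 by linarith
    qed
  qed
  define c where "c = (LEAST j. g (z (Suc j)) \<noteq> g (z 0))"
  have c: "g (z (Suc c)) \<noteq> g (z 0)" unfolding c_def using cross by (rule LeastI)
  have const: "g (z c) = g (z 0)"
  proof (cases c)
    case (Suc j)
    then show ?thesis using not_less_Least[of j "\<lambda>j. g (z (Suc j)) \<noteq> g (z 0)"] by (auto simp: c_def)
  qed simp
  have "c \<le> cf_digit m" unfolding c_def using cross by (rule Least_le)
  moreover have "hit \<rho> (Suc m) (n + c * cf_denom (Suc m) + cf_denom m)"
  proof -
    define w :: int where "w = int c * cf_num (Suc m) + cf_num m"
    have "real (n + c * cf_denom (Suc m) + cf_denom m) * \<theta> + \<rho> = z c + of_int w"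
      by (simp add: z_def y_def w_def cf_offset_def algebra_simps)
    moreover have "z c + of_int w + cf_offset (Suc m) = z (Suc c) + of_int w" by (simp add: zS)
    ultimately show ?thesis unfolding hit_iff using c const by (simp only: g_add_int)
  qed
  moreover have "hit \<rho> (Suc (Suc m)) n" if "c = cf_digit m"
    using const j0 za that unfolding hit_iff y_def[symmetric] by simp
  ultimately show thesis using that by blast
qed

text \<open>The return times to the arc are \<open>cf_denom (Suc m)\<close> and \<open>cf_denom m + cf_denom (Suc m)\<close>;
  the second premise selects the long one.\<close>

lemma hit_long_gap:
  assumes "hit \<rho> m n" "hit \<rho> (Suc m) (n + cf_denom m)" "cf_denom m < cf_denom (Suc m)"
    "0 < k" "k < cf_denom m + cf_denom (Suc m)"
  shows "\<not> hit \<rho> m (n + k)"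
proof
  assume h: "hit \<rho> m (n + k)"
  then have k: "cf_denom (Suc m) \<le> k" using hit_gap assms(1,4) by blast
  have "hit \<rho> m (n + cf_denom m + cf_denom (Suc m))"
    using hit_Suc_imp_hit[OF assms(2)] .
  then have "hit \<rho> m ((n + k) + (cf_denom m + cf_denom (Suc m) - k))"
    using assms(5) by (simp add: algebra_simps)
  then have "cf_denom (Suc m) \<le> cf_denom m + cf_denom (Suc m) - k"
    using hit_gap[OF h] assms(5) by simp
  then show False using k assms by linarith
qed

section \<open>First break times along consecutive convergents\<close>

definition first_hit :: "real \<Rightarrow> nat \<Rightarrow> nat \<Rightarrow> bool" where
  "first_hit \<rho> m T \<longleftrightarrow> hit \<rho> m T \<and> (\<forall>n<T. \<not> hit \<rho> m n)"

text \<open>An earlier hit \<open>n\<close> of index \<open>Suc m\<close> would precede the new one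
  by at least \<open>cf_denom (Suc (Suc m))\<close>, hence \<open>n\<close> is at most
  \<open>T\<close>. Equality forces the maximal \<open>c\<close> and contradicts
  \<open>not_hit_both\<close>; for smaller \<open>n\<close>, \<open>hit_Suc_imp_hit\<close> yields a
  hit of index \<open>m\<close> too soon after \<open>T\<close>.\<close>

lemma first_hit_next:
  assumes T: "first_hit \<rho> m T" "T < cf_denom (Suc m)"
  obtains c where "c \<le> cf_digit m"
    "first_hit \<rho> (Suc m) (T + c * cf_denom (Suc m) + cf_denom m)"
    "c < cf_digit m \<longrightarrow> T + c * cf_denom (Suc m) + cf_denom m < cf_denom (Suc (Suc m))"
    "c = cf_digit m \<longrightarrow> first_hit \<rho> (Suc (Suc m)) T"
proof -
  have hT: "hit \<rho> m T" using T by (simp add: first_hit_def)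
  obtain c where c: "c \<le> cf_digit m"
    "hit \<rho> (Suc m) (T + c * cf_denom (Suc m) + cf_denom m)"
    "c = cf_digit m \<longrightarrow> hit \<rho> (Suc (Suc m)) T"
    using hit_next[OF hT] by blast
  define T' where "T' = T + c * cf_denom (Suc m) + cf_denom m"
  have "\<not> hit \<rho> (Suc m) n" if "n < T'" for n
  proof
    assume n: "hit \<rho> (Suc m) n"
    have "cf_denom (Suc (Suc m)) \<le> T' - n"
      using hit_gap[OF n, of "T' - n"] c that by (simp add: T'_def)
    then have le: "n + cf_denom (Suc (Suc m)) \<le> T'" using that by linarith
    have cle: "c * cf_denom (Suc m) \<le> cf_digit m * cf_denom (Suc m)" using c by simp
    have "n \<le> T" using le cle unfolding T'_def cf_denom.simps by linarith
    show False
    proof (cases "n = T")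
      case True
      then have "cf_digit m * cf_denom (Suc m) \<le> c * cf_denom (Suc m)" using le by (simp add: T'_def)
      then have "c = cf_digit m" using c cf_denom_pos[of "Suc m"] by simp
      then show False using not_hit_both[of \<rho> m n] n c True by simp
    next
      case False
      then have nT: "n < T" using \<open>n \<le> T\<close> by simp
      have h: "hit \<rho> m (n + cf_denom (Suc m))" using hit_Suc_imp_hit[OF n] .
      moreover have "T < n + cf_denom (Suc m)" using T by simp
      ultimately have "hit \<rho> m (T + (n + cf_denom (Suc m) - T))" by simp
      then have "cf_denom (Suc m) \<le> n + cf_denom (Suc m) - T"
        using hit_gap[OF hT] \<open>T < n + cf_denom (Suc m)\<close> by simp
      then show False using nT \<open>T < n + cf_denom (Suc m)\<close> by linarith
    qed
  qed
  then have "first_hit \<rho> (Suc m) T'" using c by (simp add: first_hit_def T'_def)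
  moreover have "T' < cf_denom (Suc (Suc m))" if "c < cf_digit m"
  proof -
    have "(c + 1) * cf_denom (Suc m) \<le> cf_digit m * cf_denom (Suc m)"
      using that by (intro mult_right_mono) auto
    then show ?thesis using T by (simp add: T'_def)
  qed
  moreover have "first_hit \<rho> (Suc (Suc m)) T" if "c = cf_digit m"
    using c that T hit_Suc_Suc_imp_hit by (auto simp: first_hit_def)
  ultimately show thesis using that c unfolding T'_def by blast
qed

text \<open>The offset of index 0 is -1, a full turn, so time 0 is a hit.\<close>

lemma first_hit_0: "first_hit \<rho> 0 0"
  using g_add_1[of "\<rho> - 1"] by (simp add: first_hit_def hit_iff cf_offset_def)

text \<open>The early bound on \<open>T\<close> that \<open>first_hit_next\<close> requires can get
  lost only for the maximal \<open>c\<close>. In that case the old \<open>T\<close> already is the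
  first hit two indices further on, which the second alternative records.\<close>

lemma first_hit_cases:
  "(\<exists>T. first_hit \<rho> m T \<and> T < cf_denom (Suc m)) \<or>
   (\<exists>T. first_hit \<rho> (Suc m) T \<and> T < cf_denom m \<and> hit \<rho> m (T + cf_denom (Suc m)))"
proof (induction m)
  case 0
  then show ?case using first_hit_0 by auto
next
  case (Suc m)
  then show ?case
  proof (elim disjE exE conjE)
    fix T assume T: "first_hit \<rho> m T" "T < cf_denom (Suc m)"
    obtain c where c: "c \<le> cf_digit m"
      "first_hit \<rho> (Suc m) (T + c * cf_denom (Suc m) + cf_denom m)"
      "c < cf_digit m \<longrightarrow> T + c * cf_denom (Suc m) + cf_denom m < cf_denom (Suc (Suc m))"
      "c = cf_digit m \<longrightarrow> first_hit \<rho> (Suc (Suc m)) T"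
      by (rule first_hit_next[OF T])
    show ?thesis
    proof (cases "c = cf_digit m")
      case True
      then have "hit \<rho> (Suc m) (T + cf_denom (Suc (Suc m)))"
        using c by (simp add: first_hit_def algebra_simps)
      then show ?thesis using c True T by blast
    next
      case False
      then show ?thesis using c by (meson le_neq_implies_less)
    qed
  next
    fix T assume "first_hit \<rho> (Suc m) T" "T < cf_denom m"
    then show ?thesis using cf_denom_mono[of m "Suc (Suc m)"] by fastforce
  qed
qed

lemma ex_hit: "\<exists>n < cf_denom m + cf_denom (Suc m). hit \<rho> m n"
  using first_hit_cases[of \<rho> m]
proof (elim disjE exE conjE)
  fix T assume "first_hit \<rho> m T" "T < cf_denom (Suc m)"
  then show ?thesis by (intro exI[of _ T]) (simp add: first_hit_def)
next
  fix T assume "T < cf_denom m" "hit \<rho> m (T + cf_denom (Suc m))"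
  then show ?thesis by (intro exI[of _ "T + cf_denom (Suc m)"]) simp
qed

lemma ex_hit_from:
  obtains n where "u \<le> n" "n < u + cf_denom m + cf_denom (Suc m)" "hit \<rho> m n"
proof -
  obtain k where "k < cf_denom m + cf_denom (Suc m)" "hit (real u * \<theta> + \<rho>) m k"
    using ex_hit by blast
  then show thesis using that[of "u + k"] by (simp add: hit_add)
qed

end

section \<open>Irrationality exponents and periodic approximations\<close>

text \<open>Solutions are counted as numbers, so infinitely many are obtained from approximations
  that differ from the target and come arbitrarily close to it.\<close>

lemma irrationality_exponent_ge:
  assumes "\<And>\<eta>. 0 < \<eta> \<Longrightarrow> \<exists>(P::int) (Q::nat). 1 \<le> Q \<and> of_int P / real Q \<noteq> \<zeta> \<and>
      \<bar>\<zeta> - of_int P / real Q\<bar> < \<eta> \<and> \<bar>\<zeta> - of_int P / real Q\<bar> < real Q powr (- \<kappa>)"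
  shows "ereal \<kappa> \<le> irrationality_exponent \<zeta>"
proof -
  let ?S = "{r :: real. \<exists>(p::int) (q::nat). q \<ge> 1 \<and> r = of_int p / real q \<and>
       \<bar>\<zeta> - of_int p / real q\<bar> < real q powr (- \<kappa>)}"
  have "infinite ?S"
  proof
    assume "finite ?S"
    \<comment> \<open>The 1 keeps the set nonempty, and removing \<open>\<zeta>\<close> keeps its
      minimum positive.\<close>
    define D where "D = insert 1 ((\<lambda>r. \<bar>\<zeta> - r\<bar>) ` (?S - {\<zeta>}))"
    have fin: "finite D" using \<open>finite ?S\<close> by (simp add: D_def)
    have "0 < Min D" using fin by (subst Min_gr_iff) (auto simp: D_def)
    then obtain P :: int and Q :: nat where PQ: "1 \<le> Q" "of_int P / real Q \<noteq> \<zeta>"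
      "\<bar>\<zeta> - of_int P / real Q\<bar> < Min D" "\<bar>\<zeta> - of_int P / real Q\<bar> < real Q powr (- \<kappa>)"
      using assms by blast
    then have "of_int P / real Q \<in> ?S - {\<zeta>}" by blast
    then have "\<bar>\<zeta> - of_int P / real Q\<bar> \<in> D" by (auto simp: D_def)
    then have "Min D \<le> \<bar>\<zeta> - of_int P / real Q\<bar>" using fin by simp
    then show False using PQ by linarith
  qed
  then show ?thesis unfolding irrationality_exponent_def by (intro Sup_upper) auto
qed

lemma irrationality_exponent_le:
  fixes q0 :: nat
  assumes "0 < c" "0 \<le> \<kappa>"
    and far: "\<And>(q::nat) (p::int). 1 \<le> q \<Longrightarrow> q0 \<le> q \<Longrightarrow> c * real q powr (- \<kappa>) \<le> \<bar>\<zeta> - of_int p / real q\<bar>"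
  shows "irrationality_exponent \<zeta> \<le> ereal \<kappa>"
  unfolding irrationality_exponent_def
proof (rule Sup_least, safe)
  fix \<mu>
  let ?S = "{r :: real. \<exists>(p::int) (q::nat). q \<ge> 1 \<and> r = of_int p / real q \<and>
       \<bar>\<zeta> - of_int p / real q\<bar> < real q powr (- \<mu>)}"
  assume inf: "infinite ?S"
  show "ereal \<mu> \<le> ereal \<kappa>"
  proof (rule ccontr)
    assume "\<not> ?thesis"
    then have less: "\<kappa> < \<mu>" by simp
    \<comment> \<open>Solving \<open>c * q powr (\<mu> - \<kappa>) < 1\<close> for \<open>q\<close>
      bounds the denominators of all solutions from \<open>q0\<close> on; the numerators are then
      bounded because each solution is within 1 of \<open>\<zeta>\<close>.\<close>
    define M where "M = max q0 (nat \<lceil>(1 / c) powr (1 / (\<mu> - \<kappa>))\<rceil>)"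
    define Z where "Z = \<lceil>real M * (\<bar>\<zeta>\<bar> + 1)\<rceil>"
    have "?S \<subseteq> (\<lambda>(p, q). of_int p / real q) ` ({- Z..Z} \<times> {1..M})"
    proof
      fix r assume "r \<in> ?S"
      then obtain p :: int and q :: nat where pq: "1 \<le> q" "r = of_int p / real q"
        "\<bar>\<zeta> - of_int p / real q\<bar> < real q powr (- \<mu>)" by blast
      have "q \<le> M"
      proof (cases "q0 \<le> q")
        case True
        have "c * real q powr (- \<kappa>) < real q powr (- \<mu>)" using far[OF pq(1) True, of p] pq by linarith
        then have "c * real q powr (- \<kappa>) * real q powr \<mu> < real q powr (- \<mu>) * real q powr \<mu>"
          using pq by (intro mult_strict_right_mono) auto
        then have "c * real q powr (\<mu> - \<kappa>) < 1"
          using pq by (simp add: mult.assoc flip: powr_add)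
        then have "real q powr (\<mu> - \<kappa>) < 1 / c" using assms by (simp add: field_simps)
        then have "(real q powr (\<mu> - \<kappa>)) powr (1 / (\<mu> - \<kappa>)) < (1 / c) powr (1 / (\<mu> - \<kappa>))"
          using less by (intro powr_less_mono2) auto
        then have "real q < (1 / c) powr (1 / (\<mu> - \<kappa>))" using less pq by (simp add: powr_powr)
        then have "real q \<le> real (nat \<lceil>(1 / c) powr (1 / (\<mu> - \<kappa>))\<rceil>)"
          using real_nat_ceiling_ge[of "(1 / c) powr (1 / (\<mu> - \<kappa>))"] by linarith
        then show ?thesis by (simp add: M_def)
      qed (simp add: M_def)
      have "real q powr (- \<mu>) \<le> real q powr 0"
        using pq less assms by (intro powr_mono) auto
      then have "\<bar>\<zeta> - of_int p / real q\<bar> < 1" using pq by simp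
      then have "\<bar>of_int p / real q\<bar> \<le> \<bar>\<zeta>\<bar> + 1" by linarith
      then have "\<bar>real_of_int p\<bar> \<le> real q * (\<bar>\<zeta>\<bar> + 1)" using pq by (simp add: field_simps)
      also have "\<dots> \<le> real M * (\<bar>\<zeta>\<bar> + 1)" using \<open>q \<le> M\<close> by (intro mult_right_mono) auto
      also have "\<dots> \<le> real_of_int Z" by (simp add: Z_def)
      finally have "- Z \<le> p" "p \<le> Z" by linarith+
      then show "r \<in> (\<lambda>(p, q). of_int p / real q) ` ({- Z..Z} \<times> {1..M})"
        using pq \<open>q \<le> M\<close> by auto
    qed
    then show False using inf finite_subset by blast
  qed
qed

text \<open>Any \<open>p / q\<close> other than the approximation at scale \<open>q \<approx> b ^ n\<close> is repelled by it.\<close>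

lemma irrationality_exponent_le_of_approximations:
  fixes b :: nat
  assumes b: "2 \<le> b" and C: "1 \<le> C" and c: "0 < c" and lam: "2 \<le> \<kappa>"
    and appr: "\<And>n. n0 \<le> n \<Longrightarrow> \<exists>(P::int) (Q::nat). 1 \<le> Q \<and> real Q \<le> C * real b ^ n \<and>
      \<bar>real Q * \<zeta> - of_int P\<bar> \<le> C / real b ^ n \<and>
      c * real b powr (- \<kappa> * real n) \<le> \<bar>\<zeta> - of_int P / real Q\<bar>"
  shows "irrationality_exponent \<zeta> \<le> ereal \<kappa>"
proof -
  \<comment> \<open>\<open>c1\<close> serves the fractions different from \<open>P / Q\<close>, and
    \<open>c2\<close> the case that \<open>p / q\<close> is \<open>P / Q\<close> itself.\<close>
  define c1 where "c1 = 1 / (4 * C\<^sup>2 * real b)"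
  define c2 where "c2 = c * (2 * C * real b) powr (- \<kappa>)"
  have cpos: "0 < min c1 c2" using b C c by (simp add: c1_def c2_def)
  have far: "min c1 c2 * real q powr (- \<kappa>) \<le> \<bar>\<zeta> - of_int p / real q\<bar>"
    if q: "1 \<le> q" "b ^ n0 \<le> q" for q :: nat and p :: int
  proof -
    have qr: "1 \<le> real q" using q by simp
    \<comment> \<open>The smallest scale at which the error of \<open>P / Q\<close> is at most half
      of the least distance \<open>1 / (q * Q)\<close> of distinct fractions. Minimality keeps
      \<open>b ^ n\<close> within a constant factor of \<open>q\<close>.\<close>
    define n where "n = (LEAST n. 2 * C * real q \<le> real b ^ n)"
    have "\<exists>n. 2 * C * real q \<le> real b ^ n"
      using real_arch_pow[of "real b" "2 * C * real q"] b by (auto intro: less_imp_le)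
    then have n1: "2 * C * real q \<le> real b ^ n" unfolding n_def by (rule LeastI_ex)
    have big: "real q < 2 * C * real q" using C qr by simp
    have "real b ^ n0 \<le> real q" using q by (metis of_nat_le_iff of_nat_power)
    then have "real b ^ n0 \<le> real b ^ n" using n1 big by linarith
    then have n0: "n0 \<le> n" using b by (simp add: power_le_imp_le_exp)
    have "n \<noteq> 0" using n1 big qr by (intro notI) simp
    then obtain k where k: "n = Suc k" using not0_implies_Suc by blast
    then have "\<not> 2 * C * real q \<le> real b ^ k" unfolding n_def by (intro not_less_Least) simp
    then have n2: "real b ^ n \<le> 2 * C * real b * real q" using b k by (simp add: field_simps)
    obtain P :: int and Q :: nat where PQ: "1 \<le> Q" "real Q \<le> C * real b ^ n"
      "\<bar>real Q * \<zeta> - of_int P\<bar> \<le> C / real b ^ n"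
      "c * real b powr (- \<kappa> * real n) \<le> \<bar>\<zeta> - of_int P / real Q\<bar>"
      using appr[OF n0] by blast
    show ?thesis
    proof (cases "of_int p / real q = of_int P / real Q")
      case True
      have "c2 * real q powr (- \<kappa>) = c * (2 * C * real b * real q) powr (- \<kappa>)"
        using b C qr by (simp add: c2_def powr_mult)
      also have "\<dots> \<le> c * (real b ^ n) powr (- \<kappa>)"
        using b c lam n2 by (intro mult_left_mono powr_mono2') auto
      also have "\<dots> = c * real b powr (- \<kappa> * real n)"
        using b by (simp add: powr_powr mult.commute flip: powr_realpow)
      also have "\<dots> \<le> \<bar>\<zeta> - of_int p / real q\<bar>" using PQ True by simp
      finally show ?thesis
        using mult_right_mono[of "min c1 c2" c2 "real q powr (- \<kappa>)"] by simp
    next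
      case False
      have Qpos: "0 < real Q" "0 < real q" using PQ qr by auto
      have "p * int Q \<noteq> P * int q"
      proof
        assume "p * int Q = P * int q"
        then have "real_of_int p * real Q = real_of_int P * real q"
          by (metis of_int_mult of_int_of_nat_eq)
        then show False using False Qpos by (simp add: field_simps)
      qed
      then have "1 \<le> \<bar>p * int Q - P * int q\<bar>" by linarith
      then have "real_of_int 1 \<le> real_of_int \<bar>p * int Q - P * int q\<bar>" by (simp only: of_int_le_iff)
      then have "1 \<le> \<bar>real_of_int p * real Q - real_of_int P * real q\<bar>" by simp
      then have "1 / (real q * real Q) \<le> \<bar>real_of_int p * real Q - real_of_int P * real q\<bar> / (real q * real Q)"
        using Qpos by (intro divide_right_mono) auto
      also have "\<dots> = \<bar>of_int p / real q - of_int P / real Q\<bar>"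
      proof -
        have "of_int p / real q - of_int P / real Q
            = (real_of_int p * real Q - real_of_int P * real q) / (real q * real Q)"
          using Qpos by (simp add: field_simps)
        then show ?thesis using Qpos by (simp add: abs_mult)
      qed
      finally have sep: "1 / (real q * real Q) \<le> \<bar>of_int p / real q - of_int P / real Q\<bar>" .
      have "\<bar>real Q * \<zeta> - of_int P\<bar> \<le> 1 / (2 * real q)"
      proof -
        have "C / real b ^ n \<le> C / (2 * C * real q)"
          using n1 C b qr by (intro divide_left_mono) auto
        then show ?thesis using PQ C by simp
      qed
      then have "\<bar>real Q * \<zeta> - of_int P\<bar> / real Q \<le> 1 / (2 * real q) / real Q"
        using Qpos by (intro divide_right_mono) auto
      moreover have "\<bar>real Q * \<zeta> - of_int P\<bar> / real Q = \<bar>\<zeta> - of_int P / real Q\<bar>"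
      proof -
        have "\<zeta> - of_int P / real Q = (real Q * \<zeta> - of_int P) / real Q"
          using Qpos by (simp add: field_simps)
        then show ?thesis using Qpos by simp
      qed
      ultimately have near: "\<bar>\<zeta> - of_int P / real Q\<bar> \<le> 1 / (real q * real Q) / 2" by (simp add: field_simps)
      have "t / 2 \<le> \<bar>x - y\<bar>" if "t \<le> \<bar>y - z\<bar>" "\<bar>x - z\<bar> \<le> t / 2" for t x y z :: real
        using that by linarith
      from this[OF sep near] have "1 / (real q * real Q) / 2 \<le> \<bar>\<zeta> - of_int p / real q\<bar>" .
      moreover have "c1 * real q powr (- \<kappa>) \<le> 1 / (real q * real Q) / 2"
      proof -
        have "real Q \<le> C * (2 * C * real b * real q)"
          using PQ(2) mult_left_mono[OF n2, of C] C by linarith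
        then have "2 * real q * real Q \<le> 2 * real q * (C * (2 * C * real b * real q))"
          using qr by (intro mult_left_mono) auto
        then have "2 * real q * real Q \<le> (4 * C\<^sup>2 * real b) * (real q)\<^sup>2"
          by (simp add: power2_eq_square algebra_simps)
        then have "1 / ((4 * C\<^sup>2 * real b) * (real q)\<^sup>2) \<le> 1 / (2 * real q * real Q)"
          using Qpos by (intro divide_left_mono) (auto intro!: mult_pos_pos, use C b in auto)
        moreover have "real q powr (- \<kappa>) \<le> real q powr (- 2)" using qr lam by (intro powr_mono) auto
        moreover have "real q powr (- 2) = 1 / (real q)\<^sup>2"
          using qr by (simp add: powr_minus divide_inverse powr_numeral)
        ultimately show ?thesis
          using mult_left_mono[of "real q powr (- \<kappa>)" "1 / (real q)\<^sup>2" c1] C b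
          by (simp add: c1_def mult.commute mult.left_commute)
      qed
      ultimately show ?thesis
        using mult_right_mono[of "min c1 c2" c1 "real q powr (- \<kappa>)"] by simp
    qed
  qed
  show ?thesis
    by (rule irrationality_exponent_le[OF cpos _ far]) (use lam in auto)
qed

text \<open>Comparison with the geometric series. The factor \<open>1 - 1 / B\<close> is the one
  that summation by parts produces in the error of a periodic approximation.\<close>

lemma digit_series_bounds:
  fixes a :: "nat \<Rightarrow> real" and B :: real
  assumes B: "2 \<le> B" and a: "\<And>k. 0 \<le> a k" "\<And>k. a k \<le> 1"
  shows "summable (\<lambda>k. a k / B ^ k)"
    and "(\<And>k. k < N \<Longrightarrow> a k = 0) \<Longrightarrow> (1 - 1 / B) * (\<Sum>k. a k / B ^ k) \<le> 1 / B ^ N"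
    and "a N = 1 \<Longrightarrow> 1 / B ^ N \<le> (\<Sum>k. a k / B ^ k)"
proof -
  have geo: "summable (\<lambda>k. 1 / B ^ k)"
    using summable_geometric[of "1 / B"] B by (simp add: power_one_over)
  show sm: "summable (\<lambda>k. a k / B ^ k)"
    by (rule summable_comparison_test'[OF geo, of 0]) (use a B in \<open>simp add: divide_right_mono\<close>)
  show "(1 - 1 / B) * (\<Sum>k. a k / B ^ k) \<le> 1 / B ^ N" if z: "\<And>k. k < N \<Longrightarrow> a k = 0"
  proof -
    have "(\<Sum>k. a k / B ^ k) = (\<Sum>k. a (k + N) / B ^ (k + N)) + (\<Sum>k<N. a k / B ^ k)"
      by (rule suminf_split_initial_segment[OF sm])
    also have "(\<Sum>k<N. a k / B ^ k) = 0" using z by simp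
    also have "(\<Sum>k. a (k + N) / B ^ (k + N)) \<le> (\<Sum>k. 1 / B ^ (k + N))"
      using sm geo B a
      by (intro suminf_le) (auto intro: divide_right_mono simp: summable_iff_shift[of "\<lambda>k. a k / B ^ k"]
          summable_iff_shift[of "\<lambda>k. 1 / B ^ k"])
    also have "(\<Sum>k. 1 / B ^ (k + N)) = (\<Sum>k. (1 / B) ^ k * (1 / B ^ N))"
      by (simp add: power_add power_one_over)
    also have "\<dots> = (\<Sum>k. (1 / B) ^ k) * (1 / B ^ N)"
      using B by (intro suminf_mult2[symmetric] summable_geometric) simp
    also have "(\<Sum>k. (1 / B) ^ k) = 1 / (1 - 1 / B)"
      using B by (intro suminf_geometric) simp
    finally have "(\<Sum>k. a k / B ^ k) \<le> 1 / (1 - 1 / B) * (1 / B ^ N)" by simp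
    then have "(1 - 1 / B) * (\<Sum>k. a k / B ^ k) \<le> (1 - 1 / B) * (1 / (1 - 1 / B) * (1 / B ^ N))"
      using B by (intro mult_left_mono) auto
    then show ?thesis using B by simp
  qed
  show "1 / B ^ N \<le> (\<Sum>k. a k / B ^ k)" if "a N = 1"
    using sum_le_suminf[OF sm, of "{N}"] that a B by simp
qed

section \<open>Numbers attached to a coding and their periodic approximations\<close>

context sturmian_coding
begin

definition shift_diff :: "real \<Rightarrow> nat \<Rightarrow> nat \<Rightarrow> int" where
  "shift_diff \<rho> v n = level \<rho> (n + v) - level \<rho> n"

text \<open>Constancy of \<open>shift_diff\<close> at \<open>N\<close> consecutive indices from
  \<open>u\<close> means that the \<open>N - 1\<close> letters after position \<open>u\<close> recur
  \<open>v\<close> places later. Counting levels instead of letters causes the shifts by one in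
  later bounds.\<close>

definition agree :: "real \<Rightarrow> nat \<Rightarrow> nat \<Rightarrow> nat \<Rightarrow> bool" where
  "agree \<rho> u v N \<longleftrightarrow> (\<forall>k<N. shift_diff \<rho> v (u + k) = shift_diff \<rho> v u)"

definition number :: "nat \<Rightarrow> nat \<Rightarrow> nat \<Rightarrow> real \<Rightarrow> real" where
  "number b d0 d1 \<rho> =
     (\<Sum>n. real (if level \<rho> (Suc n) - level \<rho> n = 0 then d0 else d1) / real b ^ Suc n)"

lemma level_Suc: "level \<rho> (Suc n) - level \<rho> n = 0 \<or> level \<rho> (Suc n) - level \<rho> n = 1"
proof -
  have eq: "real (Suc n) * \<theta> + \<rho> = real n * \<theta> + \<rho> + \<theta>" by (simp add: algebra_simps)
  have "level \<rho> n \<le> level \<rho> (Suc n)" "level \<rho> (Suc n) \<le> level \<rho> n + 1"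
    unfolding level_def eq using slope_pos slope_less_1 by (auto intro!: g_mono g_le_add)
  then show ?thesis by linarith
qed

lemma shift_diff_cases:
  "shift_diff \<rho> v n = \<lfloor>real v * \<theta>\<rfloor> \<or> shift_diff \<rho> v n = \<lfloor>real v * \<theta>\<rfloor> + 1"
proof -
  let ?y = "real n * \<theta> + \<rho>" and ?l = "\<lfloor>real v * \<theta>\<rfloor>"
  have eq: "real (n + v) * \<theta> + \<rho> = ?y + real v * \<theta>" by (simp add: algebra_simps)
  have "g (?y + of_int ?l) \<le> g (?y + real v * \<theta>)" by (intro g_mono) simp
  moreover have "g (?y + real v * \<theta>) \<le> g (?y + of_int (?l + 1))" by (intro g_mono) linarith
  ultimately show ?thesis unfolding shift_diff_def level_def g_add_int eq by linarith
qed

text \<open>Since \<open>shift_diff\<close> takes only two consecutive values, summation by parts turns the error into a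
  series whose terms all have the same sign, so that the first disagreement determines its size.\<close>

lemma periodic_approximation:
  assumes b: "2 \<le> b" and d: "d0 < b" "d1 < b" "d0 \<noteq> d1" and v: "1 \<le> v"
  obtains P :: int where
    "\<And>N. agree \<rho> u v N \<Longrightarrow>
       \<bar>real (b ^ u * (b ^ v - 1)) * number b d0 d1 \<rho> - of_int P\<bar> \<le> real b / real b ^ N"
    "\<And>N. \<lbrakk>agree \<rho> u v N; shift_diff \<rho> v (u + N) \<noteq> shift_diff \<rho> v u\<rbrakk> \<Longrightarrow>
       1 / (2 * real b ^ N) \<le> \<bar>real (b ^ u * (b ^ v - 1)) * number b d0 d1 \<rho> - of_int P\<bar>"
proof -
  define B where "B = real b"
  have B2: "2 \<le> B" using b by (simp add: B_def)
  define \<delta> where "\<delta> = int d1 - int d0"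
  define s where "s n = level \<rho> (Suc n) - level \<rho> n" for n
  define x where "x n = (if s n = 0 then d0 else d1)" for n
  have x: "real (x n) = real d0 + of_int \<delta> * of_int (s n)" for n
    using level_Suc[of \<rho> n] unfolding s_def[symmetric] by (auto simp: x_def \<delta>_def)
  define f where "f w = (\<Sum>k. real (x (w + k)) / B ^ Suc k)" for w
  have sm: "summable (\<lambda>k. real (x (w + k)) / B ^ Suc k)" for w
  proof -
    have "summable (\<lambda>k. (real (x (w + k)) / B) / B ^ k)"
      by (rule digit_series_bounds(1)) (use B2 d in \<open>auto simp: x_def B_def\<close>)
    then show ?thesis by simp
  qed
  have rec: "B * f w = real (x w) + f (Suc w)" for w
  proof -
    have "f w = real (x w) / B + (\<Sum>k. real (x (w + Suc k)) / B ^ Suc (Suc k))"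
      unfolding f_def using suminf_split_head[OF sm[of w]] by simp
    also have "(\<Sum>k. real (x (w + Suc k)) / B ^ Suc (Suc k)) = (\<Sum>k. (real (x (Suc w + k)) / B ^ Suc k) / B)"
      by (simp add: field_simps)
    also have "\<dots> = f (Suc w) / B" unfolding f_def by (rule suminf_divide[OF sm])
    finally show ?thesis using B2 by (simp add: field_simps)
  qed
  \<comment> \<open>Multiplication by \<open>B ^ w\<close> moves \<open>w\<close> digits in front of
    the point and leaves the tail \<open>f w\<close>. Taking the difference for
    \<open>w = u + v\<close> and \<open>w = u\<close> produces the numerator
    \<open>P\<close>.\<close>
  have int: "\<exists>A::int. B ^ w * f 0 = of_int A + f w" for w
  proof (induction w)
    case 0 show ?case by (intro exI[of _ 0]) simp
  next
    case (Suc w)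
    then obtain A :: int where A: "B ^ w * f 0 = of_int A + f w" by blast
    have "B ^ Suc w * f 0 = B * (B ^ w * f 0)" by simp
    also have "\<dots> = B * of_int A + real (x w) + f (Suc w)" unfolding A using rec[of w] by (simp add: algebra_simps)
    also have "\<dots> = of_int (int b * A + int (x w)) + f (Suc w)" by (simp add: B_def)
    finally show ?case by blast
  qed
  obtain A1 A2 :: int where A: "B ^ u * f 0 = of_int A1 + f u" "B ^ (u + v) * f 0 = of_int A2 + f (u + v)"
    using int by blast
  define P where "P = A2 - A1"
  have Q: "real (b ^ u * (b ^ v - 1)) = B ^ (u + v) - B ^ u"
    using b by (simp add: B_def algebra_simps power_add of_nat_diff)
  have main: "real (b ^ u * (b ^ v - 1)) * f 0 - of_int P = f (u + v) - f u"
    unfolding Q using A by (simp add: P_def algebra_simps)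
  define D where "D k = shift_diff \<rho> v (u + k) - shift_diff \<rho> v u" for k
  \<comment> \<open>\<open>D\<close> starts at 0 and \<open>shift_diff\<close> has only two values,
    so the nonzero values of \<open>D\<close> all equal this sign.\<close>
  define e where "e = (if shift_diff \<rho> v u = \<lfloor>real v * \<theta>\<rfloor> then 1 else (-1 :: real))"
  define a where "a k = \<bar>real_of_int (D k)\<bar>" for k
  have Da: "of_int (D k) = e * a k" and a01: "a k = 0 \<or> a k = 1" for k
    using shift_diff_cases[of \<rho> v u] shift_diff_cases[of \<rho> v "u + k"]
    by (auto simp: D_def e_def a_def)
  have a: "0 \<le> a k" "a k \<le> 1" for k using a01[of k] by auto
  note bounds = digit_series_bounds[of B a, OF B2 a]
  define E where "E = (\<Sum>k. a k / B ^ k)"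
  have a0: "a 0 = 0" by (simp add: a_def D_def)
  have E1: "(\<Sum>k. a (Suc k) / B ^ Suc k) = E"
    using suminf_split_head[OF bounds(1)] a0 by (simp add: E_def)
  have E2: "(\<Sum>k. a k / B ^ Suc k) = E / B"
    using suminf_divide[OF bounds(1), of B] by (simp add: E_def field_simps)
  have sm1: "summable (\<lambda>k. a (Suc k) / B ^ Suc k)"
    using bounds(1) by (simp only: summable_Suc_iff[of "\<lambda>k. a k / B ^ k"])
  have sm2: "summable (\<lambda>k. a k / B ^ Suc k)"
    using summable_divide[OF bounds(1), of B] by (simp add: field_simps)
  \<comment> \<open>A difference of letters is an increment of \<open>D\<close>; this is the
    summation by parts.\<close>
  have diff_term: "real (x (u + v + k)) / B ^ Suc k - real (x (u + k)) / B ^ Suc k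
      = of_int \<delta> * e * (a (Suc k) / B ^ Suc k - a k / B ^ Suc k)" for k
  proof -
    have "s (u + v + k) - s (u + k) = D (Suc k) - D k"
      by (simp add: s_def D_def shift_diff_def algebra_simps)
    then have "real_of_int (s (u + v + k)) - of_int (s (u + k)) = e * a (Suc k) - e * a k"
      unfolding Da[symmetric] by (metis of_int_diff)
    then have "of_int \<delta> * (real_of_int (s (u + v + k)) - of_int (s (u + k)))
        = of_int \<delta> * (e * a (Suc k) - e * a k)" by (rule arg_cong)
    then have "real (x (u + v + k)) - real (x (u + k)) = of_int \<delta> * e * (a (Suc k) - a k)"
      unfolding x by (simp add: right_diff_distrib mult.assoc)
    then show ?thesis unfolding diff_divide_distrib[symmetric] by simp
  qed
  have "f (u + v) - f u = (\<Sum>k. real (x (u + v + k)) / B ^ Suc k - real (x (u + k)) / B ^ Suc k)"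
    unfolding f_def by (rule suminf_diff[OF sm sm])
  also have "\<dots> = (\<Sum>k. of_int \<delta> * e * (a (Suc k) / B ^ Suc k - a k / B ^ Suc k))"
    by (simp only: diff_term)
  also have "\<dots> = of_int \<delta> * e * (\<Sum>k. a (Suc k) / B ^ Suc k - a k / B ^ Suc k)"
    by (rule suminf_mult[OF summable_diff[OF sm1 sm2]])
  also have "(\<Sum>k. a (Suc k) / B ^ Suc k - a k / B ^ Suc k) = E - E / B"
    using suminf_diff[OF sm1 sm2] E1 E2 by simp
  finally have diff: "f (u + v) - f u = of_int \<delta> * e * ((1 - 1 / B) * E)" by (simp add: algebra_simps)
  have E0: "0 \<le> E" unfolding E_def using a B2 by (intro suminf_nonneg bounds(1)) auto
  have e1: "\<bar>e\<bar> = 1" by (simp add: e_def)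
  have B0: "0 \<le> (1 - 1 / B) * E" using E0 B2 by simp
  have absdiff: "\<bar>f (u + v) - f u\<bar> = \<bar>of_int \<delta>\<bar> * ((1 - 1 / B) * E)"
    unfolding diff abs_mult[of _ "(1 - 1 / B) * E"] abs_mult[of _ e] using e1 B0 by simp
  have \<delta>1: "1 \<le> \<bar>real_of_int \<delta>\<bar>" "\<bar>real_of_int \<delta>\<bar> \<le> B" using d by (auto simp: \<delta>_def B_def)
  have num: "number b d0 d1 \<rho> = f 0" by (simp add: number_def f_def x_def s_def B_def)
  have zero: "a k = 0" if "agree \<rho> u v N" "k < N" for N k
    using that by (simp add: a_def D_def agree_def)
  show thesis
  proof (rule that[of P])
    fix N assume N: "agree \<rho> u v N"
    have "(1 - 1 / B) * E \<le> 1 / B ^ N" unfolding E_def using bounds(2) zero[OF N] by blast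
    then have "\<bar>real_of_int \<delta>\<bar> * ((1 - 1 / B) * E) \<le> B * (1 / B ^ N)"
      using \<delta>1 B2 B0 by (intro mult_mono) auto
    then show "\<bar>real (b ^ u * (b ^ v - 1)) * number b d0 d1 \<rho> - of_int P\<bar> \<le> real b / real b ^ N"
      unfolding num main absdiff by (simp add: B_def)
    assume "shift_diff \<rho> v (u + N) \<noteq> shift_diff \<rho> v u"
    then have "a N = 1" using a01[of N] by (auto simp: a_def D_def)
    then have "1 / B ^ N \<le> E" unfolding E_def using bounds(3) by blast
    moreover have "1 / 2 \<le> 1 - 1 / B" using B2 by (simp add: field_simps)
    ultimately have "1 / 2 * (1 / B ^ N) \<le> (1 - 1 / B) * E" using B2 E0 by (intro mult_mono) auto
    also have "\<dots> \<le> \<bar>real_of_int \<delta>\<bar> * ((1 - 1 / B) * E)" using \<delta>1 B0 mult_right_mono[of 1 "\<bar>real_of_int \<delta>\<bar>"] by force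
    finally show "1 / (2 * real b ^ N) \<le> \<bar>real (b ^ u * (b ^ v - 1)) * number b d0 d1 \<rho> - of_int P\<bar>"
      unfolding num main absdiff by (simp add: B_def)
  qed
qed

end

section \<open>Upper bound and Dirichlet-type repetitions\<close>

context sturmian_coding
begin

text \<open>For such \<open>v\<close> the fractional part of \<open>v * \<theta>\<close> stays at
  least \<open>cf_error m\<close> away from both 0 and 1. A jump just ahead of time \<open>n\<close>
  is therefore on the same side of the rotation by \<open>v\<close> for every hit, and a jump next
  to time \<open>n + v\<close> is on the other side; the parity of \<open>m\<close> decides which
  value of \<open>shift_diff\<close> goes with which.\<close>

lemma hit_shift_diff:
  assumes v: "1 \<le> v" "v < cf_denom (Suc m)"
  obtains S1 S2 where "S1 \<noteq> S2" "\<And>n. hit \<rho> m n \<Longrightarrow> shift_diff \<rho> v n = S1"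
    "\<And>n. hit \<rho> m (n + v) \<Longrightarrow> shift_diff \<rho> v n = S2"
proof -
  define p where "p = \<lfloor>real v * \<theta>\<rfloor>"
  define \<phi> where "\<phi> = real v * \<theta> - of_int p"
  have a1: "cf_error m \<le> \<phi>"
    using best_approximation[of v m p] v by (simp add: \<phi>_def p_def)
  have a2: "cf_error m \<le> 1 - \<phi>"
  proof -
    have "\<bar>real v * \<theta> - of_int (p + 1)\<bar> = 1 - \<phi>" unfolding \<phi>_def p_def of_int_add by linarith
    then show ?thesis using best_approximation[of v m "p + 1"] v by simp
  qed
  have fwd: "shift_diff \<rho> v n = g (real n * \<theta> + \<rho> + \<phi>) - g (real n * \<theta> + \<rho>) + p" for n
  proof -
    have "real (n + v) * \<theta> + \<rho> = real n * \<theta> + \<rho> + \<phi> + of_int p" by (simp add: \<phi>_def algebra_simps)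
    then show ?thesis unfolding shift_diff_def level_def by (simp only: g_add_int)
  qed
  have bwd: "shift_diff \<rho> v n = g (real (n + v) * \<theta> + \<rho>) - g (real (n + v) * \<theta> + \<rho> - \<phi>) + p" for n
  proof -
    have "real n * \<theta> + \<rho> = real (n + v) * \<theta> + \<rho> - \<phi> + of_int (- p)" by (simp add: \<phi>_def algebra_simps)
    then show ?thesis unfolding shift_diff_def level_def by (simp only: g_add_int)
  qed
  have cases: "shift_diff \<rho> v n = p \<or> shift_diff \<rho> v n = p + 1" for n
    unfolding p_def by (rule shift_diff_cases)
  show thesis
  proof (cases rule: cf_offset_cases[of m])
    case pos
    show thesis
    proof (rule that[of "p + 1" p])
      fix n assume "hit \<rho> m n"
      then have "g (real n * \<theta> + \<rho> + cf_error m) \<noteq> g (real n * \<theta> + \<rho>)" using pos by (simp add: hit_iff)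
      moreover have "g (real n * \<theta> + \<rho>) \<le> g (real n * \<theta> + \<rho> + cf_error m)"
        "g (real n * \<theta> + \<rho> + cf_error m) \<le> g (real n * \<theta> + \<rho> + \<phi>)"
        using a1 cf_error_pos[of m] by (auto intro!: g_mono)
      ultimately have "shift_diff \<rho> v n > p" unfolding fwd by linarith
      then show "shift_diff \<rho> v n = p + 1" using cases[of n] by linarith
    next
      fix n assume "hit \<rho> m (n + v)"
      then have "g (real (n + v) * \<theta> + \<rho> + cf_error m) \<noteq> g (real (n + v) * \<theta> + \<rho>)"
        using pos by (simp only: hit_iff) simp
      moreover have "g (real (n + v) * \<theta> + \<rho>) \<le> g (real (n + v) * \<theta> + \<rho> + cf_error m)"
        using cf_error_pos[of m] by (intro g_mono) simp
      moreover have "g (real (n + v) * \<theta> + \<rho> + cf_error m) \<le> g (real (n + v) * \<theta> + \<rho> - \<phi>) + 1"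
        using a2 by (intro g_le_add) linarith
      ultimately have "shift_diff \<rho> v n \<le> p" unfolding bwd by linarith
      then show "shift_diff \<rho> v n = p" using cases[of n] by linarith
    qed simp
  next
    case neg
    show thesis
    proof (rule that[of p "p + 1"])
      fix n assume "hit \<rho> m n"
      then have "g (real n * \<theta> + \<rho> - cf_error m) \<noteq> g (real n * \<theta> + \<rho>)" using neg by (simp add: hit_iff)
      moreover have "g (real n * \<theta> + \<rho> - cf_error m) \<le> g (real n * \<theta> + \<rho>)"
        using cf_error_pos[of m] by (intro g_mono) simp
      moreover have "g (real n * \<theta> + \<rho> + \<phi>) \<le> g (real n * \<theta> + \<rho> - cf_error m) + 1"
        using a2 by (intro g_le_add) linarith
      ultimately have "shift_diff \<rho> v n \<le> p" unfolding fwd by linarith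
      then show "shift_diff \<rho> v n = p" using cases[of n] by linarith
    next
      fix n assume "hit \<rho> m (n + v)"
      then have "g (real (n + v) * \<theta> + \<rho> - cf_error m) \<noteq> g (real (n + v) * \<theta> + \<rho>)"
        using neg by (simp only: hit_iff) simp
      moreover have "g (real (n + v) * \<theta> + \<rho> - cf_error m) \<le> g (real (n + v) * \<theta> + \<rho>)"
        "g (real (n + v) * \<theta> + \<rho> - \<phi>) \<le> g (real (n + v) * \<theta> + \<rho> - cf_error m)"
        using a1 cf_error_pos[of m] by (auto intro!: g_mono)
      ultimately have "shift_diff \<rho> v n > p" unfolding bwd by linarith
      then show "shift_diff \<rho> v n = p + 1" using cases[of n] by linarith
    qed simp
  qed
qed

text \<open>A longer window contains both a hit and a time that lies \<open>v\<close> before a hit,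
  and at these two times \<open>shift_diff\<close> takes different values.\<close>

lemma agree_length_le:
  assumes v: "1 \<le> v" "v < cf_denom (Suc m)" and agree: "agree \<rho> u v N"
  shows "N \<le> cf_denom m + cf_denom (Suc m)"
proof (rule ccontr)
  assume N: "\<not> ?thesis"
  obtain S1 S2 where S: "S1 \<noteq> S2" "\<And>n. hit \<rho> m n \<Longrightarrow> shift_diff \<rho> v n = S1"
    "\<And>n. hit \<rho> m (n + v) \<Longrightarrow> shift_diff \<rho> v n = S2"
    using hit_shift_diff[OF v] by blast
  have const: "shift_diff \<rho> v n = shift_diff \<rho> v u" if "u \<le> n" "n < u + N" for n
    using agree that unfolding agree_def by (metis le_Suc_ex nat_add_left_cancel_less)
  obtain n1 where n1: "u \<le> n1" "n1 < u + cf_denom m + cf_denom (Suc m)" "hit \<rho> m n1"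
    by (rule ex_hit_from)
  obtain n2 where n2: "u + v \<le> n2" "n2 < u + v + cf_denom m + cf_denom (Suc m)" "hit \<rho> m n2"
    by (rule ex_hit_from)
  have "shift_diff \<rho> v n1 = shift_diff \<rho> v u" using n1 N by (intro const) auto
  moreover have "shift_diff \<rho> v (n2 - v) = shift_diff \<rho> v u" using n2 N by (intro const) auto
  moreover have "shift_diff \<rho> v (n2 - v) = S2" using S(3)[of "n2 - v"] n2 by simp
  ultimately show False using S(1) S(2)[OF n1(3)] by simp
qed

lemma ex_disagree:
  assumes v: "1 \<le> v"
  obtains N where "agree \<rho> u v N" "shift_diff \<rho> v (u + N) \<noteq> shift_diff \<rho> v u"
proof -
  obtain m where m: "v < cf_denom (Suc m)" using ex_cf_denom_bracket[OF v] by blast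
  have "\<exists>N. shift_diff \<rho> v (u + N) \<noteq> shift_diff \<rho> v u"
  proof (rule ccontr)
    assume "\<not> ?thesis"
    then have "agree \<rho> u v (Suc (cf_denom m + cf_denom (Suc m)))" by (simp add: agree_def)
    then show False using agree_length_le[OF v m] by fastforce
  qed
  from LeastI_ex[OF this] show thesis
    by (rule that[rotated]) (auto simp: agree_def dest: not_less_Least)
qed

text \<open>The denominator is about \<open>b ^ (u + v)\<close> and the error at most a constant
  times \<open>b\<close> to the power \<open>-(u + v + N)\<close>. Any exponent below
  \<open>1 + x\<close> leaves a power of \<open>b\<close> that absorbs the constant.\<close>

lemma exponent_ge_of_agree:
  assumes b: "2 \<le> b" and d: "d0 < b" "d1 < b" "d0 \<noteq> d1" and x: "0 \<le> x"
    and long: "\<And>N0. \<exists>u v N. 1 \<le> v \<and> N0 \<le> u + v \<and> x * real (u + v) - C \<le> real N \<and> agree \<rho> u v N"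
  shows "ereal (1 + x) \<le> irrationality_exponent (number b d0 d1 \<rho>)"
proof -
  define \<zeta> where "\<zeta> = number b d0 d1 \<rho>"
  define M where "M = 2 * real b * real b powr C"
  have B: "1 < real b" "0 < M" using b by (auto simp: M_def)
  have key: "ereal \<kappa> \<le> irrationality_exponent \<zeta>" if \<kappa>: "0 \<le> \<kappa>" "\<kappa> < 1 + x" for \<kappa>
  proof (rule irrationality_exponent_ge)
    fix \<eta> :: real assume \<eta>: "0 < \<eta>"
    define t where "t = 1 + x - \<kappa>"
    have t: "0 < t" using \<kappa> by (simp add: t_def)
    \<comment> \<open>Chosen so that \<open>M\<close> is below both \<open>b powr (A * t)\<close>
      and \<open>\<eta> * b powr A\<close>. The summand 1 makes these bounds strict.\<close>
    define N0 where "N0 = nat \<lceil>max ((log b M + 1) / t) (log b (M / \<eta>) + 1)\<rceil>"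
    obtain u v N where uvN: "1 \<le> v" "N0 \<le> u + v" "x * real (u + v) - C \<le> real N" "agree \<rho> u v N"
      using long by blast
    define A where "A = real (u + v)"
    have "max ((log b M + 1) / t) (log b (M / \<eta>) + 1) \<le> A"
      using uvN(2) real_nat_ceiling_ge[of "max ((log b M + 1) / t) (log b (M / \<eta>) + 1)"]
      unfolding N0_def A_def by linarith
    then have "(log b M + 1) / t \<le> A" and A2: "log b (M / \<eta>) < A" by auto
    then have A1: "log b M < A * t" using t by (simp add: pos_divide_le_eq)
    have M1: "M < real b powr (A * t)" using A1 B by (simp add: log_less_iff)
    have M2: "M < \<eta> * real b powr A" using A2 B \<eta> by (simp add: log_less_iff field_simps)
    obtain P :: int where P: "\<And>N. agree \<rho> u v N \<Longrightarrow>
        \<bar>real (b ^ u * (b ^ v - 1)) * \<zeta> - of_int P\<bar> \<le> real b / real b ^ N"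
      "\<And>N. \<lbrakk>agree \<rho> u v N; shift_diff \<rho> v (u + N) \<noteq> shift_diff \<rho> v u\<rbrakk> \<Longrightarrow>
        1 / (2 * real b ^ N) \<le> \<bar>real (b ^ u * (b ^ v - 1)) * \<zeta> - of_int P\<bar>"
      using periodic_approximation[OF b d uvN(1), of \<rho> u] unfolding \<zeta>_def by blast
    define Q where "Q = b ^ u * (b ^ v - 1)"
    have bv: "2 \<le> b ^ v"
    proof -
      have "b ^ 1 \<le> b ^ v" using b uvN(1) by (intro power_increasing) auto
      then show ?thesis using b by simp
    qed
    have Q1: "1 \<le> Q" using bv b by (simp add: Q_def Suc_le_eq)
    have Qle: "real Q \<le> real b powr A"
    proof -
      have "Q \<le> b ^ u * b ^ v" by (simp add: Q_def)
      then have "real Q \<le> real b ^ (u + v)" by (metis of_nat_le_iff of_nat_power power_add)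
      then show ?thesis using B by (simp add: A_def powr_realpow del: of_nat_add)
    qed
    have Qge: "real b powr A \<le> 2 * real Q"
    proof -
      have "b ^ v \<le> 2 * (b ^ v - 1)" using bv by linarith
      then have "b ^ u * b ^ v \<le> b ^ u * (2 * (b ^ v - 1))" by simp
      then have "b ^ (u + v) \<le> 2 * Q" by (simp add: Q_def power_add)
      then have "real (b ^ (u + v)) \<le> real (2 * Q)" by (simp only: of_nat_le_iff)
      then show ?thesis using B by (simp add: A_def powr_realpow del: of_nat_add)
    qed
    have err: "\<bar>\<zeta> - of_int P / real Q\<bar> = \<bar>real Q * \<zeta> - of_int P\<bar> / real Q"
    proof -
      have "\<zeta> - of_int P / real Q = (real Q * \<zeta> - of_int P) / real Q" using Q1 by (simp add: field_simps)
      then show ?thesis by simp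
    qed
    have "\<bar>real Q * \<zeta> - of_int P\<bar> \<le> real b / real b ^ N" using P(1)[OF uvN(4)] by (simp only: Q_def)
    also have "\<dots> \<le> real b / real b powr (x * A - C)"
    proof (rule divide_left_mono)
      show "real b powr (x * A - C) \<le> real b ^ N"
        using uvN(3) B by (simp add: A_def flip: powr_realpow)
    qed (use B in auto)
    finally have e1: "\<bar>real Q * \<zeta> - of_int P\<bar> \<le> real b / real b powr (x * A - C)" .
    have "\<bar>\<zeta> - of_int P / real Q\<bar> \<le> (real b / real b powr (x * A - C)) / (real b powr A / 2)"
      unfolding err using e1 Qge Q1 B by (intro frac_le) auto
    also have "\<dots> = M * real b powr (- (1 + x) * A)"
      using B by (simp add: M_def powr_diff powr_add powr_minus field_simps)
    finally have e2: "\<bar>\<zeta> - of_int P / real Q\<bar> \<le> M * real b powr (- (1 + x) * A)" .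
    have "M * real b powr (- (1 + x) * A) = M * real b powr (- A) * real b powr (- x * A)"
      by (simp add: algebra_simps flip: powr_add)
    also have "\<dots> \<le> M * real b powr (- A) * 1"
    proof (rule mult_left_mono)
      have "real b powr (- x * A) \<le> real b powr 0" using B x by (intro powr_mono) (auto simp: A_def)
      then show "real b powr (- x * A) \<le> 1" using B by simp
    qed (use B in auto)
    also have "\<dots> < \<eta>" using M2 B by (simp add: powr_minus field_simps)
    finally have small: "\<bar>\<zeta> - of_int P / real Q\<bar> < \<eta>" using e2 by linarith
    have "M * real b powr (- (1 + x) * A) = M * real b powr (- (A * t)) * real b powr (- \<kappa> * A)"
      by (simp add: t_def algebra_simps flip: powr_add)
    also have "\<dots> < 1 * real b powr (- \<kappa> * A)"
      using M1 B by (intro mult_strict_right_mono) (auto simp: powr_minus field_simps)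
    also have "\<dots> = (real b powr A) powr (- \<kappa>)" by (simp add: powr_powr mult.commute)
    also have "\<dots> \<le> real Q powr (- \<kappa>)" using Qle Q1 \<kappa> by (intro powr_mono2') auto
    finally have small2: "\<bar>\<zeta> - of_int P / real Q\<bar> < real Q powr (- \<kappa>)" using e2 by linarith
    obtain N' where "agree \<rho> u v N'" "shift_diff \<rho> v (u + N') \<noteq> shift_diff \<rho> v u"
      using ex_disagree[OF uvN(1)] by blast
    then have "1 / (2 * real b ^ N') \<le> \<bar>real Q * \<zeta> - of_int P\<bar>" using P(2) by (simp only: Q_def)
    moreover have "0 < 1 / (2 * real b ^ N')" using B by simp
    ultimately have "0 < \<bar>real Q * \<zeta> - of_int P\<bar>" by linarith
    then have "real Q * \<zeta> \<noteq> of_int P" by simp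
    then have "of_int P / real Q \<noteq> \<zeta>" using Q1 by (auto simp: field_simps)
    then show "\<exists>(P::int) (Q::nat). 1 \<le> Q \<and> of_int P / real Q \<noteq> \<zeta> \<and>
        \<bar>\<zeta> - of_int P / real Q\<bar> < \<eta> \<and> \<bar>\<zeta> - of_int P / real Q\<bar> < real Q powr (- \<kappa>)"
      using small small2 Q1 by blast
  qed
  show ?thesis
  proof (rule dense_le)
    fix y :: ereal assume y: "y < ereal (1 + x)"
    show "y \<le> irrationality_exponent (number b d0 d1 \<rho>)"
    proof (cases y)
      case (real r)
      then have "ereal (max r 0) \<le> irrationality_exponent \<zeta>" using y x by (intro key) auto
      moreover have "ereal r \<le> ereal (max r 0)" by simp
      ultimately show ?thesis unfolding real \<zeta>_def by (rule order_trans[rotated])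
    qed (use y in auto)
  qed
qed

text \<open>The repetitions supply the approximations at every scale that
  \<open>irrationality_exponent_le_of_approximations\<close> asks for. The constant
  \<open>b ^ 2\<close> there absorbs the slack of one allowed in \<open>u + v\<close> and in
  \<open>N\<close>.\<close>

lemma exponent_le_of_agree:
  assumes b: "2 \<le> b" and d: "d0 < b" "d1 < b" "d0 \<noteq> d1" and \<kappa>: "2 \<le> \<kappa>"
    and appr: "\<And>n. K \<le> n \<Longrightarrow> \<exists>u v N. 1 \<le> v \<and> u + v \<le> Suc n \<and> n \<le> Suc N \<and> agree \<rho> u v N \<and>
      shift_diff \<rho> v (u + N) \<noteq> shift_diff \<rho> v u \<and> real (u + v + N) \<le> \<kappa> * real n + C"
  shows "irrationality_exponent (number b d0 d1 \<rho>) \<le> ereal \<kappa>"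
proof -
  define \<zeta> where "\<zeta> = number b d0 d1 \<rho>"
  have B: "1 < real b" using b by simp
  show ?thesis unfolding \<zeta>_def[symmetric]
  proof (rule irrationality_exponent_le_of_approximations[OF b, where C = "real b ^ 2" and c = "real b powr (- C) / 2"])
    fix n assume "K \<le> n"
    then obtain u v N where uvN: "1 \<le> v" "u + v \<le> Suc n" "n \<le> Suc N" "agree \<rho> u v N"
      "shift_diff \<rho> v (u + N) \<noteq> shift_diff \<rho> v u" "real (u + v + N) \<le> \<kappa> * real n + C"
      using appr by blast
    obtain P :: int where P: "\<And>N. agree \<rho> u v N \<Longrightarrow>
        \<bar>real (b ^ u * (b ^ v - 1)) * \<zeta> - of_int P\<bar> \<le> real b / real b ^ N"
      "\<And>N. \<lbrakk>agree \<rho> u v N; shift_diff \<rho> v (u + N) \<noteq> shift_diff \<rho> v u\<rbrakk> \<Longrightarrow>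
        1 / (2 * real b ^ N) \<le> \<bar>real (b ^ u * (b ^ v - 1)) * \<zeta> - of_int P\<bar>"
      using periodic_approximation[OF b d uvN(1), of \<rho> u] unfolding \<zeta>_def by blast
    define Q where "Q = b ^ u * (b ^ v - 1)"
    have "2 ^ 1 \<le> b ^ v" using b uvN(1) by (meson le_trans one_le_numeral power_increasing power_mono zero_le)
    then have Q1: "1 \<le> Q" using b by (simp add: Q_def Suc_le_eq)
    have "Q \<le> b ^ u * b ^ v" by (simp add: Q_def)
    then have Qle: "real Q \<le> real b ^ (u + v)" by (metis of_nat_le_iff of_nat_power power_add)
    also have "\<dots> \<le> real b ^ (2 + n)" using B uvN(2) by (intro power_increasing) auto
    finally have Q2: "real Q \<le> real b ^ 2 * real b ^ n" unfolding power_add .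
    have "\<bar>real Q * \<zeta> - of_int P\<bar> \<le> real b / real b ^ N" using P(1)[OF uvN(4)] by (simp only: Q_def)
    also have "\<dots> = real b ^ 2 / real b ^ Suc N" using B by (simp add: power2_eq_square)
    also have "\<dots> \<le> real b ^ 2 / real b ^ n"
      using B uvN(3) by (intro divide_left_mono power_increasing) auto
    finally have Q3: "\<bar>real Q * \<zeta> - of_int P\<bar> \<le> real b ^ 2 / real b ^ n" .
    have err: "\<bar>\<zeta> - of_int P / real Q\<bar> = \<bar>real Q * \<zeta> - of_int P\<bar> / real Q"
    proof -
      have "\<zeta> - of_int P / real Q = (real Q * \<zeta> - of_int P) / real Q" using Q1 by (simp add: field_simps)
      then show ?thesis by simp
    qed
    have "real b powr (- C) / 2 * real b powr (- \<kappa> * real n) = real b powr (- (\<kappa> * real n + C)) / 2"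
      by (simp add: add.commute flip: powr_add)
    also have "\<dots> \<le> real b powr (- real (u + v + N)) / 2"
      using uvN(6) B by (intro divide_right_mono powr_mono) auto
    also have "\<dots> = (1 / (2 * real b ^ N)) / real b ^ (u + v)"
      using B by (simp add: powr_minus powr_realpow power_add field_simps del: of_nat_add)
    also have "\<dots> \<le> \<bar>real Q * \<zeta> - of_int P\<bar> / real Q"
      using P(2)[OF uvN(4,5), folded Q_def] Qle Q1 by (intro frac_le) auto
    finally have Q4: "real b powr (- C) / 2 * real b powr (- \<kappa> * real n) \<le> \<bar>\<zeta> - of_int P / real Q\<bar>"
      unfolding err .
    show "\<exists>(P::int) (Q::nat). 1 \<le> Q \<and> real Q \<le> real b ^ 2 * real b ^ n \<and>
      \<bar>real Q * \<zeta> - of_int P\<bar> \<le> real b ^ 2 / real b ^ n \<and>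
      real b powr (- C) / 2 * real b powr (- \<kappa> * real n) \<le> \<bar>\<zeta> - of_int P / real Q\<bar>"
      using Q1 Q2 Q3 Q4 by blast
  qed (use B \<kappa> in auto)
qed

text \<open>The Sturmian pigeonhole principle: the vectors \<open>(shift_diff \<rho> k i)\<^sub>k\<^sub>\<le>\<^sub>n\<close> form a chain in the
  product order and each component takes two consecutive values, so there are at most \<open>n + 1\<close> of them.\<close>

lemma ex_agree:
  obtains u v where "1 \<le> v" "u + v \<le> Suc n" "agree \<rho> u v (Suc n)"
proof -
  \<comment> \<open>On a chain the sum of the coordinates already separates vectors, and only
    \<open>n + 1\<close> sums are possible for \<open>n + 2\<close> indices.\<close>
  define S where "S i = (\<Sum>k=1..n. shift_diff \<rho> k i)" for i
  define L where "L = (\<Sum>k=1..n. \<lfloor>real k * \<theta>\<rfloor>)"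
  have "S ` {..Suc n} \<subseteq> {L..L + int n}"
  proof safe
    fix i
    have "L \<le> S i" unfolding L_def S_def
      by (rule sum_mono) (use shift_diff_cases[of \<rho> _ i] in \<open>smt (verit)\<close>)
    moreover have "S i \<le> (\<Sum>k=1..n. \<lfloor>real k * \<theta>\<rfloor> + 1)" unfolding S_def
      by (rule sum_mono) (use shift_diff_cases[of \<rho> _ i] in \<open>smt (verit)\<close>)
    ultimately show "S i \<in> {L..L + int n}" by (simp add: L_def sum.distrib)
  qed
  then have "card (S ` {..Suc n}) \<le> card {L..L + int n}" by (intro card_mono) auto
  then have "card (S ` {..Suc n}) < card {..Suc n}" by simp
  then have "\<not> inj_on S {..Suc n}" by (rule pigeonhole)
  then obtain i j where "i \<le> Suc n" "j \<le> Suc n" "S i = S j" "i \<noteq> j" by (auto simp: inj_on_def)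
  then obtain i j where ij: "j \<le> Suc n" "S i = S j" "i < j" by (metis linorder_neqE_nat)
  \<comment> \<open>Every coordinate is a monotone function of \<open>y i\<close>, which gives the
    chain property.\<close>
  define y where "y i = real i * \<theta> + \<rho> - of_int (level \<rho> i)" for i
  have sd: "shift_diff \<rho> k i = g (real k * \<theta> + y i)" for k i
  proof -
    have "real (i + k) * \<theta> + \<rho> = real k * \<theta> + y i + of_int (level \<rho> i)"
      by (simp add: y_def algebra_simps)
    then show ?thesis unfolding shift_diff_def level_def[of \<rho> "i + k"] by (simp only: g_add_int)
  qed
  have eq: "shift_diff \<rho> k i = shift_diff \<rho> k j" if k: "k \<in> {1..n}" for k
  proof (rule ccontr)
    assume ne: "shift_diff \<rho> k i \<noteq> shift_diff \<rho> k j"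
    have *: "S i' < S j'" if "y i' \<le> y j'" "shift_diff \<rho> k i' \<noteq> shift_diff \<rho> k j'" for i' j'
    proof -
      have le: "shift_diff \<rho> k i' \<le> shift_diff \<rho> k j'" for k unfolding sd using that by (intro g_mono) simp
      then have "shift_diff \<rho> k i' < shift_diff \<rho> k j'" using that by (simp add: order_less_le)
      then show ?thesis unfolding S_def using le k by (intro sum_strict_mono_ex1) auto
    qed
    then show False using ij ne *[of i j] *[of j i] by (metis less_irrefl linear)
  qed
  have "agree \<rho> i (j - i) (Suc n)" unfolding agree_def
  proof safe
    fix k assume "k < Suc n"
    then have "shift_diff \<rho> k i = shift_diff \<rho> k j"
      using eq[of k] by (cases "k = 0") (auto simp: shift_diff_def)
    then have "level \<rho> (i + k) - level \<rho> i = level \<rho> (j + k) - level \<rho> j" by (simp add: shift_diff_def)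
    moreover have eqs: "i + k + (j - i) = j + k" "i + (j - i) = j" using ij by auto
    ultimately show "shift_diff \<rho> (j - i) (i + k) = shift_diff \<rho> (j - i) i"
      unfolding shift_diff_def eqs by linarith
  qed
  then show thesis using ij by (intro that[of "j - i" i]) auto
qed

text \<open>At scale \<open>n\<close> the pigeonhole repetition has \<open>u + v\<close> at most
  \<open>n + 1\<close>, while its length is at most \<open>cf_denom m + cf_denom (Suc m)\<close>,
  hence at most \<open>1 + x\<close> times its period. Together these give
  \<open>2 + x\<close>.\<close>

lemma sturmian_exponent_le:
  assumes b: "2 \<le> b" and d: "d0 < b" "d1 < b" "d0 \<noteq> d1"
    and x: "0 \<le> x" and ratio: "\<And>m. m0 \<le> m \<Longrightarrow> real (cf_denom (Suc m)) \<le> x * real (cf_denom m)"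
  shows "irrationality_exponent (number b d0 d1 \<rho>) \<le> ereal (2 + x)"
proof (rule exponent_le_of_agree[OF b d, where C = "2 + x" and K = "2 * cf_denom (Suc m0)"])
  fix n assume n: "2 * cf_denom (Suc m0) \<le> n"
  obtain u v where uv: "1 \<le> v" "u + v \<le> Suc n" "agree \<rho> u v (Suc n)" by (rule ex_agree)
  obtain N where N: "agree \<rho> u v N" "shift_diff \<rho> v (u + N) \<noteq> shift_diff \<rho> v u"
    using ex_disagree[OF uv(1)] by blast
  have "n < N" using N(2) uv(3) unfolding agree_def by (metis not_less_eq)
  obtain m where m: "1 \<le> m" "cf_denom m \<le> v" "v < cf_denom (Suc m)"
    using ex_cf_denom_bracket[OF uv(1)] by blast
  have le: "N \<le> cf_denom m + cf_denom (Suc m)" using agree_length_le[OF uv(1) m(3) N(1)] .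
  \<comment> \<open>A smaller index would limit the length to \<open>2 * cf_denom (Suc m0)\<close>,
    but the repetition is longer than \<open>n\<close>.\<close>
  have "m0 \<le> m"
  proof (rule ccontr)
    assume "\<not> ?thesis"
    then have "cf_denom m \<le> cf_denom (Suc m0)" "cf_denom (Suc m) \<le> cf_denom (Suc m0)"
      by (auto intro: cf_denom_mono)
    then show False using le \<open>n < N\<close> n by linarith
  qed
  then have "real N \<le> (1 + x) * real (cf_denom m)"
    using ratio[of m] of_nat_mono[OF le, where 'a = real] by (simp add: algebra_simps)
  also have "\<dots> \<le> (1 + x) * real (Suc n)" using m(2) uv(2) x by (intro mult_left_mono) auto
  finally have "real N \<le> (1 + x) * real (Suc n)" .
  moreover have "real (u + v) \<le> real (Suc n)" using uv(2) by (simp only: of_nat_le_iff)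
  ultimately have "real (u + v + N) \<le> (2 + x) * real n + (2 + x)" by (simp add: algebra_simps)
  then show "\<exists>u v N. 1 \<le> v \<and> u + v \<le> Suc n \<and> n \<le> Suc N \<and> agree \<rho> u v N \<and>
      shift_diff \<rho> v (u + N) \<noteq> shift_diff \<rho> v u \<and> real (u + v + N) \<le> (2 + x) * real n + (2 + x)"
    using uv N \<open>n < N\<close> by (intro exI[of _ u] exI[of _ v] exI[of _ N]) auto
qed (use x in auto)

end

section \<open>Lower bound\<close>

text \<open>The inequalities force the digits \<open>a\<close> to be eventually periodic with period \<open>2, 1, 1\<close>. Along a
  period the pair \<open>(p, q) = (Q j, Q (Suc j))\<close> at a digit \<open>2\<close> becomes \<open>(p + 3 q, 2 p + 5 q)\<close>, so that
  \<open>t j - q + p / 3\<close> is invariant and \<open>q / p\<close> tends to \<open>(2 + sqrt 10) / 3\<close>; the last assumption then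
  fails in the limit.\<close>

lemma ratio_gap_contradiction:
  fixes Q t :: "nat \<Rightarrow> real" and a :: "nat \<Rightarrow> nat" and x :: real
  assumes x: "x < 2 / 3 + 4 * sqrt 10 / 15"
    and a: "\<And>j. 1 \<le> a j"
    and Q0: "\<And>j. 0 < Q j" and Q1: "\<And>j. Q j + 1 \<le> Q (Suc j)"
    and Q2: "\<And>j. Q (Suc (Suc j)) = Q j + real (a j) * Q (Suc j)"
    and t0: "\<And>j. 0 \<le> t j" and t1: "\<And>j. t (Suc j) = t j + Q j" and t2: "\<And>j. t j \<le> Q (Suc j)"
    and short1: "\<And>j. t j < x * Q j"
    and short2: "\<And>j. Q j + Q (Suc j) < x * t (Suc j)"
    and short3: "\<And>j. t j + Q j + Q (Suc j) < x * (Q j + Q (Suc j))"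
  shows False
proof -
  define r where "r = sqrt 10"
  have r2: "r * r = 10" by (simp add: r_def)
  have r3: "3 < r" unfolding r_def by (rule real_less_rsqrt) simp
  have r4: "r < 31623 / 10000" unfolding r_def by (rule real_less_lsqrt) (simp_all add: power2_eq_square)
  \<comment> \<open>A rational number slightly above the critical constant 1.50995..., so that all
    restrictions on the digits become linear arithmetic.\<close>
  have x1: "x \<le> 151 / 100" using x r4 unfolding r_def by linarith
  have G1: "t j \<le> 151 / 100 * Q j" for j
    using short1[of j] mult_right_mono[OF x1, of "Q j"] Q0[of j] by linarith
  have G2: "Q j + Q (Suc j) \<le> 151 / 100 * t (Suc j)" for j
    using short2[of j] mult_right_mono[OF x1, of "t (Suc j)"] t0[of "Suc j"] by linarith
  have G3: "t j + Q j + Q (Suc j) \<le> 151 / 100 * (Q j + Q (Suc j))" for j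
    using short3[of j] mult_right_mono[OF x1, of "Q j + Q (Suc j)"] Q0[of j] Q0[of "Suc j"] by linarith
  have a12: "a j = 1 \<or> a j = 2" for j
  proof (rule ccontr)
    assume "\<not> ?thesis"
    then have "3 \<le> a j" using a[of j] by linarith
    then have "3 * Q (Suc j) \<le> real (a j) * Q (Suc j)" using Q0[of "Suc j"] by (intro mult_right_mono) auto
    then show False
      using Q2[of j] G1[of "Suc j"] G2[of "Suc j"] t1[of "Suc j"] Q0[of j] Q0[of "Suc j"] by linarith
  qed
  have no22: "\<not> (a j = 2 \<and> a (Suc j) = 2)" for j
  proof
    assume "a j = 2 \<and> a (Suc j) = 2"
    then have "Q (Suc (Suc j)) = Q j + 2 * Q (Suc j)"
      "Q (Suc (Suc (Suc j))) = Q (Suc j) + 2 * Q (Suc (Suc j))" using Q2[of j] Q2[of "Suc j"] by auto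
    then show False
      using G2[of "Suc (Suc j)"] t1[of j] t1[of "Suc j"] t1[of "Suc (Suc j)"] t2[of j] Q0[of j] Q0[of "Suc j"] Q1[of j]
      by linarith
  qed
  have no212: "\<not> (a j = 2 \<and> a (Suc j) = 1 \<and> a (Suc (Suc j)) = 2)" for j
  proof
    assume "a j = 2 \<and> a (Suc j) = 1 \<and> a (Suc (Suc j)) = 2"
    then have "Q (Suc (Suc j)) = Q j + 2 * Q (Suc j)"
      "Q (Suc (Suc (Suc j))) = Q (Suc j) + Q (Suc (Suc j))"
      "Q (Suc (Suc (Suc (Suc j)))) = Q (Suc (Suc j)) + 2 * Q (Suc (Suc (Suc j)))"
      using Q2[of j] Q2[of "Suc j"] Q2[of "Suc (Suc j)"] by auto
    then show False
      using G1[of "Suc j"] G2[of "Suc (Suc (Suc j))"] t1[of j] t1[of "Suc j"] t1[of "Suc (Suc j)"]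
        t1[of "Suc (Suc (Suc j))"] t2[of j] Q0[of j] Q0[of "Suc j"] Q1[of j]
      by linarith
  qed
  have no111: "\<not> (a j = 1 \<and> a (Suc j) = 1 \<and> a (Suc (Suc j)) = 1)" for j
  proof
    assume "a j = 1 \<and> a (Suc j) = 1 \<and> a (Suc (Suc j)) = 1"
    then have "Q (Suc (Suc j)) = Q j + Q (Suc j)"
      "Q (Suc (Suc (Suc j))) = Q (Suc j) + Q (Suc (Suc j))"
      "Q (Suc (Suc (Suc (Suc j)))) = Q (Suc (Suc j)) + Q (Suc (Suc (Suc j)))"
      using Q2[of j] Q2[of "Suc j"] Q2[of "Suc (Suc j)"] by auto
    then have "t j + 47 / 100 * Q j \<le> 55 / 100 * Q (Suc j)"
      using G3[of "Suc (Suc (Suc j))"] t1[of j] t1[of "Suc j"] t1[of "Suc (Suc j)"]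
      by (simp add: algebra_simps)
    then show False using G2[of j] t1[of j] t0[of j] Q0[of j] by linarith
  qed
  have period: "a (Suc j) = 1 \<and> a (Suc (Suc j)) = 1 \<and> a (Suc (Suc (Suc j))) = 2" if "a j = 2" for j
    using that no22[of j] no212[of j] no111[of "Suc j"] a12[of "Suc j"] a12[of "Suc (Suc j)"]
      a12[of "Suc (Suc (Suc j))"] by auto
  obtain i where i: "a i = 2" using no111[of 0] a12 by metis
  define p q T where "p k = Q (i + 3 * k)" and "q k = Q (Suc (i + 3 * k))" and "T k = t (i + 3 * k)" for k
  have two: "a (i + 3 * k) = 2" for k
  proof (induction k)
    case (Suc k)
    then show ?case using period[of "i + 3 * k"] by (simp add: eval_nat_numeral)
  qed (simp add: i)
  have step: "p (Suc k) = p k + 3 * q k" "q (Suc k) = 2 * p k + 5 * q k" "T (Suc k) = T k + 2 * p k + 3 * q k" for k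
  proof -
    define j where "j = i + 3 * k"
    have j: "i + 3 * Suc k = Suc (Suc (Suc j))" by (simp add: j_def)
    have "a j = 2" using two[of k] by (simp add: j_def)
    note ds = this period[OF this]
    have "Q (Suc (Suc j)) = Q j + 2 * Q (Suc j)"
      "Q (Suc (Suc (Suc j))) = Q (Suc j) + Q (Suc (Suc j))"
      "Q (Suc (Suc (Suc (Suc j)))) = Q (Suc (Suc j)) + Q (Suc (Suc (Suc j)))"
      using Q2[of j] Q2[of "Suc j"] Q2[of "Suc (Suc j)"] ds by auto
    then show "p (Suc k) = p k + 3 * q k" "q (Suc k) = 2 * p k + 5 * q k" "T (Suc k) = T k + 2 * p k + 3 * q k"
      unfolding p_def q_def T_def j j_def[symmetric]
      using t1[of j] t1[of "Suc j"] t1[of "Suc (Suc j)"] by linarith+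
  qed
  define C where "C = T 0 - q 0 + p 0 / 3"
  have inv: "T k - q k + p k / 3 = C" for k
  proof (induction k)
    case (Suc k)
    then show ?case unfolding step by (simp add: add_divide_distrib)
  qed (simp add: C_def)
  \<comment> \<open>The positive fixed point of the map that a period induces on
    \<open>q / p\<close>. The deviation \<open>e\<close> belongs to the other eigenvalue
    \<open>3 - sqrt 10\<close>, of modulus below 1, and stays bounded.\<close>
  define \<phi> where "\<phi> = (2 + r) / 3"
  define e where "e k = q k - \<phi> * p k" for k
  have contract: "e (Suc k) = (3 - r) * e k" for k
  proof -
    have "\<phi> * (3 - r) = \<phi> - 2"
    proof -
      have "(2 + r) * (3 - r) = r - 4" using r2 by (simp add: algebra_simps)
      then show ?thesis by (simp add: \<phi>_def)
    qed
    moreover have "3 * \<phi> = 2 + r" by (simp add: \<phi>_def)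
    ultimately have "\<phi> * (3 - r) * p k = (\<phi> - 2) * p k" "3 * \<phi> * q k = (2 + r) * q k" by simp_all
    then show ?thesis unfolding e_def step by (simp add: algebra_simps)
  qed
  have bound: "\<bar>e k\<bar> \<le> \<bar>e 0\<bar>" for k
  proof (induction k)
    case (Suc k)
    have "\<bar>e (Suc k)\<bar> = \<bar>3 - r\<bar> * \<bar>e k\<bar>" by (simp add: contract abs_mult)
    also have "\<dots> \<le> 1 * \<bar>e k\<bar>" using r3 r4 by (intro mult_right_mono) auto
    finally show ?case using Suc by linarith
  qed simp
  define K0 where "K0 = 2 / 3 + 4 * r / 15"
  have xK: "0 < K0 - x" using x by (simp add: K0_def r_def)
  have main: "(K0 - x) * p k \<le> \<bar>e 0\<bar> - C" for k
  proof -
    have "T k + p k + q k < x * (p k + q k)" using short3[of "i + 3 * k"] by (simp add: p_def q_def T_def)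
    \<comment> \<open>Up to bounded terms \<open>T k\<close> is \<open>q k - p k / 3\<close>, so
      \<open>short3\<close> compares \<open>2 * q + 2 * p / 3\<close> with
      \<open>x * (p + q)\<close>; at \<open>q = \<phi> * p\<close> equality holds exactly for
      \<open>x = K0\<close>.\<close>
    moreover have "(2 - K0) * \<phi> = K0 - 2 / 3"
      using r2 by (simp add: K0_def \<phi>_def field_simps)
    then have "(2 - K0) * \<phi> * p k = (K0 - 2 / 3) * p k" by simp
    then have "2 * q k + 2 / 3 * p k - K0 * (p k + q k) = (2 - K0) * e k"
      by (simp add: e_def algebra_simps)
    moreover have "- \<bar>e 0\<bar> \<le> (2 - K0) * e k"
    proof -
      have "\<bar>(2 - K0) * e k\<bar> \<le> 1 * \<bar>e 0\<bar>" unfolding abs_mult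
        using bound[of k] r3 r4 by (intro mult_mono) (auto simp: K0_def)
      then show ?thesis by linarith
    qed
    moreover have "x * (p k + q k) = K0 * (p k + q k) - (K0 - x) * p k - (K0 - x) * q k"
      by (simp add: algebra_simps)
    moreover have "0 \<le> (K0 - x) * q k" using xK Q0[of "Suc (i + 3 * k)"] by (simp add: q_def)
    ultimately show ?thesis using inv[of k] by linarith
  qed
  have grow: "real k \<le> p k" for k
  proof (induction k)
    case 0
    then show ?case using Q0[of i] by (simp add: p_def)
  next
    case (Suc k)
    have "1 \<le> q k" using Q1[of "i + 3 * k"] Q0[of "i + 3 * k"] by (simp add: q_def)
    then show ?case using Suc by (simp add: step)
  qed
  obtain k :: nat where "(\<bar>e 0\<bar> - C) / (K0 - x) < real k" using reals_Archimedean2 by blast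
  then have "\<bar>e 0\<bar> - C < (K0 - x) * real k" using xK by (simp add: pos_divide_less_eq mult.commute)
  also have "\<dots> \<le> (K0 - x) * p k" using xK grow[of k] by (intro mult_left_mono) auto
  finally show False using main[of k] by linarith
qed

context sturmian_coding
begin

lemma shift_diff_not_hit: "\<not> hit \<rho> m n \<Longrightarrow> shift_diff \<rho> (cf_denom m) n = cf_num m"
  by (simp add: hit_def shift_diff_def)

lemma agree_of_not_hit:
  assumes "\<And>k. k < N \<Longrightarrow> \<not> hit \<rho> m (u + k)"
  shows "agree \<rho> u (cf_denom m) N"
  unfolding agree_def
proof safe
  fix k assume k: "k < N"
  then show "shift_diff \<rho> (cf_denom m) (u + k) = shift_diff \<rho> (cf_denom m) u"
    using shift_diff_not_hit[OF assms[of k]] shift_diff_not_hit[of \<rho> m u] assms[of 0] by simp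
qed

text \<open>The period \<open>cf_denom m + cf_denom (Suc m)\<close> belongs to an intermediate convergent.\<close>

lemma agree_denom_sum:
  assumes T: "first_hit \<rho> m T" "hit \<rho> (Suc m) (T + cf_denom m)" "cf_denom m < cf_denom (Suc m)"
  shows "agree \<rho> 0 (cf_denom m + cf_denom (Suc m)) (T + cf_denom m + cf_denom (Suc m))"
proof -
  define v l where "v = cf_denom m + cf_denom (Suc m)" and "l = cf_num m + cf_num (Suc m)"
  define e where "e = cf_offset m + cf_offset (Suc m)"
  let ?y = "\<lambda>n. real n * \<theta> + \<rho>"
  have sd: "shift_diff \<rho> v n = g (?y n + e) - g (?y n) + l" for n
  proof -
    have "real (n + v) * \<theta> + \<rho> = ?y n + e + of_int l"
      by (simp add: v_def l_def e_def cf_offset_def algebra_simps)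
    then show ?thesis unfolding shift_diff_def level_def by (simp only: g_add_int)
  qed
  have less: "cf_error (Suc m) < cf_error m" by (rule cf_error_Suc_less)
  have sand: "(g (?y n) \<le> g (?y n + e) \<and> g (?y n + e) \<le> g (?y n + cf_offset m)) \<or>
      (g (?y n + cf_offset m) \<le> g (?y n + e) \<and> g (?y n + e) \<le> g (?y n))" for n
  proof (cases rule: cf_offset_cases[of m])
    case pos
    then have "g (?y n) \<le> g (?y n + e) \<and> g (?y n + e) \<le> g (?y n + cf_offset m)"
      using less by (auto simp: e_def intro!: g_mono)
    then show ?thesis ..
  next
    case neg
    then have "g (?y n + cf_offset m) \<le> g (?y n + e) \<and> g (?y n + e) \<le> g (?y n)"
      using less by (auto simp: e_def intro!: g_mono)
    then show ?thesis ..
  qed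
  have small: "\<bar>g (?y n + cf_offset m) - g (?y n)\<bar> \<le> 1" for n
  proof -
    have o: "\<bar>cf_offset m\<bar> \<le> 1" using abs_cf_offset[of m] cf_error_le_1[of m] by simp
    have "g (?y n + cf_offset m) \<le> g (?y n) + 1" using o by (intro g_le_add) linarith
    moreover have "g (?y n) \<le> g (?y n + cf_offset m) + 1" using o by (intro g_le_add) linarith
    ultimately show ?thesis by linarith
  qed
  have "shift_diff \<rho> v n = l" if n: "n < T + v" for n
  proof (cases "n = T")
    case True
    \<comment> \<open>At \<open>T\<close> itself the return step crosses the jump back, so the
      combined step crosses nothing although \<open>cf_offset m\<close> does.\<close>
    have "g (?y T + cf_offset m + cf_offset (Suc m)) \<noteq> g (?y T + cf_offset m)"
      using T(2) unfolding hit_add_denom_iff .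
    then have "g (?y T + e) \<noteq> g (?y T + cf_offset m)" by (simp add: e_def add.assoc)
    then have "g (?y T + e) = g (?y T)" using sand[of T] small[of T] by linarith
    then show ?thesis using True by (simp add: sd)
  next
    case False
    have "\<not> hit \<rho> m n"
    proof (cases "n < T")
      case True
      then show ?thesis using T(1) by (simp add: first_hit_def)
    next
      case F: False
      then show ?thesis
        using hit_long_gap[of \<rho> m T "n - T"] T False n by (simp add: first_hit_def v_def)
    qed
    then have "g (?y n + cf_offset m) = g (?y n)" by (simp add: hit_iff)
    then have "g (?y n + e) = g (?y n)" using sand[of n] by linarith
    then show ?thesis by (simp add: sd)
  qed
  then show ?thesis unfolding agree_def v_def[symmetric] add.assoc by (cases "T + v") auto
qed

text \<open>A smaller exponent bounds the length of every repetition far out. Applied to the prefix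
  before a first hit, to the short and long gaps after a hit, and to the prefix of period
  \<open>cf_denom m + cf_denom (Suc m)\<close>, this gives the assumptions of
  \<open>ratio_gap_contradiction\<close>.\<close>

lemma sturmian_exponent_ge:
  assumes b: "2 \<le> b" and d: "d0 < b" "d1 < b" "d0 \<noteq> d1"
  shows "ereal (5 / 3 + 4 * sqrt 10 / 15) \<le> irrationality_exponent (number b d0 d1 \<rho>)"
proof (rule ccontr)
  assume "\<not> ?thesis"
  then obtain z where z: "irrationality_exponent (number b d0 d1 \<rho>) < z" "z < ereal (5 / 3 + 4 * sqrt 10 / 15)"
    using dense not_le by metis
  then obtain z' where z': "z = ereal z'" by (cases z) auto
  define x where "x = max 0 (z' - 1)"
  have x0: "0 \<le> x" by (simp add: x_def)
  have xK: "x < 2 / 3 + 4 * sqrt 10 / 15"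
  proof -
    have "0 \<le> sqrt 10" by simp
    moreover have "z' < 5 / 3 + 4 * sqrt 10 / 15" using z(2) z' by simp
    ultimately show ?thesis unfolding x_def by linarith
  qed
  have x2: "x \<le> 2"
  proof -
    have "sqrt 10 < 4" by (rule real_less_lsqrt) simp_all
    then show ?thesis using xK by linarith
  qed
  have "z \<le> ereal (1 + x)" by (simp add: z' x_def)
  then have "\<not> ereal (1 + x) \<le> irrationality_exponent (number b d0 d1 \<rho>)" using z(1) by (meson leD le_less_trans not_le order_trans)
  \<comment> \<open>The 3 pays for starting one place after a hit and stopping one place before the
    next, as \<open>x\<close> is at most 2.\<close>
  then have "\<not> (\<forall>N0. \<exists>u v N. 1 \<le> v \<and> N0 \<le> u + v \<and> x * real (u + v) - 3 \<le> real N \<and> agree \<rho> u v N)"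
    using exponent_ge_of_agree[OF b d x0] by blast
  then obtain N0 where short: "\<And>u v N. 1 \<le> v \<Longrightarrow> N0 \<le> u + v \<Longrightarrow> agree \<rho> u v N \<Longrightarrow> real N < x * real (u + v) - 3"
    by (metis not_le)
  define m0 where "m0 = N0 + 2"
  have big: "1 \<le> cf_denom m" "N0 \<le> cf_denom m" "cf_denom m < cf_denom (Suc m)" if "m0 \<le> m" for m
  proof -
    have "m = Suc (Suc (m - 2))" using that by (simp add: m0_def)
    then show "cf_denom m < cf_denom (Suc m)" using cf_denom_less_Suc[of "m - 2"] by metis
    show "N0 \<le> cf_denom m" using cf_denom_ge[of m] that by (simp add: m0_def)
    show "1 \<le> cf_denom m" using cf_denom_pos[of m] that by (simp add: m0_def Suc_le_eq)
  qed
  have h1: "real T < x * real (cf_denom m)" if "m0 \<le> m" "first_hit \<rho> m T" for m T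
    using short[of "cf_denom m" 0 T] big[OF that(1)] agree_of_not_hit[of T \<rho> m 0] that(2)
    by (simp add: first_hit_def)
  have h2: "real (cf_denom (Suc m)) < x * (real T + real (cf_denom m))" if "m0 \<le> m" "hit \<rho> m T" for m T
  proof -
    have "\<not> hit \<rho> m (Suc T + k)" if "k < cf_denom (Suc m) - 1" for k
      using hit_gap[OF \<open>hit \<rho> m T\<close>, of "Suc k"] that by auto
    then have "agree \<rho> (Suc T) (cf_denom m) (cf_denom (Suc m) - 1)" by (rule agree_of_not_hit)
    then have "real (cf_denom (Suc m) - 1) < x * real (Suc T + cf_denom m) - 3"
      using big[OF that(1)] by (intro short) auto
    then show ?thesis using x2 big[OF that(1)] by (simp add: of_nat_diff algebra_simps)
  qed
  have h3: "real (cf_denom m) + real (cf_denom (Suc m)) < x * (real T + real (cf_denom m))"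
    if "m0 \<le> m" "hit \<rho> m T" "hit \<rho> (Suc m) (T + cf_denom m)" for m T
  proof -
    have "\<not> hit \<rho> m (Suc T + k)" if "k < cf_denom m + cf_denom (Suc m) - 1" for k
      using hit_long_gap[OF \<open>hit \<rho> m T\<close> \<open>hit \<rho> (Suc m) (T + cf_denom m)\<close>, of "Suc k"]
        big[OF \<open>m0 \<le> m\<close>] that by auto
    then have "agree \<rho> (Suc T) (cf_denom m) (cf_denom m + cf_denom (Suc m) - 1)" by (rule agree_of_not_hit)
    then have "real (cf_denom m + cf_denom (Suc m) - 1) < x * real (Suc T + cf_denom m) - 3"
      using big[OF that(1)] by (intro short) auto
    then show ?thesis using x2 big[OF that(1)] by (simp add: of_nat_diff algebra_simps)
  qed
  have h4: "real T + real (cf_denom m) + real (cf_denom (Suc m)) < x * (real (cf_denom m) + real (cf_denom (Suc m)))"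
    if "m0 \<le> m" "first_hit \<rho> m T" "hit \<rho> (Suc m) (T + cf_denom m)" for m T
    using short[OF _ _ agree_denom_sum[OF that(2,3)]] big[OF that(1)] by simp
  have next_hit: "first_hit \<rho> (Suc m) (T + cf_denom m) \<and> T + cf_denom m < cf_denom (Suc (Suc m))"
    if m: "m0 \<le> m" and T: "first_hit \<rho> m T" "T < cf_denom (Suc m)" for m T
  proof -
    obtain c where c: "c \<le> cf_digit m"
      "first_hit \<rho> (Suc m) (T + c * cf_denom (Suc m) + cf_denom m)"
      "c < cf_digit m \<longrightarrow> T + c * cf_denom (Suc m) + cf_denom m < cf_denom (Suc (Suc m))"
      by (rule first_hit_next[OF T])
    \<comment> \<open>For positive \<open>c\<close> the prefix before the new first hit gives
      \<open>S + q < x * q\<close>, and the gap after \<open>T\<close> gives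
      \<open>q < x * S\<close>; both cannot hold for \<open>x\<close> at most 1.51. Hence each first
      hit is the previous one plus \<open>cf_denom m\<close>.\<close>
    have "c = 0"
    proof (rule ccontr)
      assume "c \<noteq> 0"
      then have le: "1 * real (cf_denom (Suc m)) \<le> real c * real (cf_denom (Suc m))"
        by (intro mult_right_mono) auto
      define S q where "S = real T + real (cf_denom m)" and "q = real (cf_denom (Suc m))"
      have q: "0 < q" using cf_denom_pos[of "Suc m"] by (simp add: q_def)
      have S: "0 \<le> S" by (simp add: S_def)
      have "S + real c * q < x * q" using h1[OF _ c(2)] m by (simp add: S_def q_def algebra_simps)
      then have "S + q < x * q" using le by (simp add: q_def)
      moreover have "q < x * S" using h2[OF m] T(1) by (simp add: first_hit_def S_def q_def)
      moreover have "x \<le> 151 / 100"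
      proof -
        have "sqrt 10 < 31623 / 10000" by (rule real_less_lsqrt) (simp_all add: power2_eq_square)
        then show ?thesis using xK by linarith
      qed
      then have "x * q \<le> 151 / 100 * q" "x * S \<le> 151 / 100 * S"
        using q S by (simp_all only: mult_right_mono less_imp_le)
      ultimately show False using q by linarith
    qed
    then show ?thesis using c cf_digit_pos[of m] by simp
  qed
  obtain m1 T1 where start: "m0 \<le> m1" "first_hit \<rho> m1 T1" "T1 < cf_denom (Suc m1)"
    using first_hit_cases[of \<rho> m0]
  proof (elim disjE exE conjE)
    fix T assume "first_hit \<rho> (Suc m0) T" "T < cf_denom m0"
    then show thesis using that[of "Suc m0" T] cf_denom_mono[of m0 "Suc (Suc m0)"] by simp
  qed (use that in blast)
  define t where "t j = T1 + (\<Sum>k<j. cf_denom (m1 + k))" for j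
  have fh: "first_hit \<rho> (m1 + j) (t j) \<and> t j < cf_denom (Suc (m1 + j))" for j
  proof (induction j)
    case 0
    then show ?case using start by (simp add: t_def)
  next
    case (Suc j)
    then show ?case using next_hit[of "m1 + j" "t j"] start(1) by (simp add: t_def add.assoc)
  qed
  have hit': "hit \<rho> (m1 + j) (t j)" "hit \<rho> (Suc (m1 + j)) (t j + cf_denom (m1 + j))" for j
    using fh[of j] fh[of "Suc j"] by (auto simp: first_hit_def t_def add.assoc)
  have ge: "m0 \<le> m1 + j" for j using start(1) by simp
  show False
  proof (rule ratio_gap_contradiction[where x = x and a = "\<lambda>j. cf_digit (m1 + j)"
        and Q = "\<lambda>j. real (cf_denom (m1 + j))" and t = "\<lambda>j. real (t j)"])
    fix j
    show "1 \<le> cf_digit (m1 + j)" using cf_digit_pos[of "m1 + j"] by simp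
    show "0 < real (cf_denom (m1 + j))" using big(1)[OF ge[of j]] by simp
    show "real (cf_denom (m1 + j)) + 1 \<le> real (cf_denom (m1 + Suc j))" using big(3)[OF ge[of j]] by simp
    show "real (cf_denom (m1 + Suc (Suc j))) = real (cf_denom (m1 + j)) + real (cf_digit (m1 + j)) * real (cf_denom (m1 + Suc j))"
      by simp
    show "real (t j) \<le> real (cf_denom (m1 + Suc j))" using fh[of j] by simp
    show "real (t (Suc j)) = real (t j) + real (cf_denom (m1 + j))" by (simp add: t_def)
    show "real (t j) < x * real (cf_denom (m1 + j))" using h1[OF ge] fh by blast
    show "real (cf_denom (m1 + j)) + real (cf_denom (m1 + Suc j)) < x * real (t (Suc j))"
      using h3[OF ge hit'[of j]] by (simp add: t_def algebra_simps)
    show "real (t j) + real (cf_denom (m1 + j)) + real (cf_denom (m1 + Suc j))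
        < x * (real (cf_denom (m1 + j)) + real (cf_denom (m1 + Suc j)))"
      using h4[OF ge, of j "t j"] fh[of j] hit'(2)[of j] by simp
  qed (use xK in auto)
qed

end

section \<open>The characteristic word and the extremal intercept\<close>

context irrational_slope
begin

interpretation lower: sturmian_coding \<theta> "floor :: real \<Rightarrow> int"
  by unfold_locales (auto intro: monoI floor_mono)

text \<open>With intercept \<open>\<theta>\<close> the point at time \<open>n\<close> is
  \<open>(n + 1) * \<theta>\<close>. It first comes closer to an integer than
  \<open>cf_error m\<close> when \<open>n + 1\<close> is \<open>cf_denom (Suc m)\<close>, and there
  it lies on the side from which \<open>cf_offset m\<close> crosses.\<close>

lemma first_hit_characteristic:
  assumes "1 \<le> m"
  shows "lower.first_hit \<theta> m (cf_denom (Suc m) - 1)"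
  unfolding lower.first_hit_def
proof safe
  have pos: "0 < cf_denom (Suc m)" by (rule cf_denom_pos) simp
  define y where "y = real (cf_denom (Suc m)) * \<theta>"
  have y: "real (cf_denom (Suc m) - 1) * \<theta> + \<theta> = y"
    using pos by (simp add: y_def of_nat_diff algebra_simps)
  have y': "y = of_int (cf_num (Suc m)) + cf_offset (Suc m)" by (simp add: y_def cf_offset_def)
  have less: "cf_error (Suc m) < cf_error m" by (rule cf_error_Suc_less)
  have "\<lfloor>y + cf_offset m\<rfloor> \<noteq> \<lfloor>y\<rfloor>"
  proof (cases rule: cf_offset_cases[of m])
    case pos
    then have "\<lfloor>y\<rfloor> < cf_num (Suc m)" "cf_num (Suc m) \<le> \<lfloor>y + cf_offset m\<rfloor>"
      using less y' by (auto simp: floor_less_iff le_floor_iff)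
    then show ?thesis by linarith
  next
    case neg
    then have "\<lfloor>y + cf_offset m\<rfloor> < cf_num (Suc m)" "cf_num (Suc m) \<le> \<lfloor>y\<rfloor>"
      using less y' by (auto simp: floor_less_iff le_floor_iff)
    then show ?thesis by linarith
  qed
  then show "lower.hit \<theta> m (cf_denom (Suc m) - 1)" unfolding lower.hit_iff y .
  fix n assume n: "n < cf_denom (Suc m) - 1" "lower.hit \<theta> m n"
  define k where "k = Suc n"
  have k: "0 < k" "k < cf_denom (Suc m)" using n by (auto simp: k_def)
  have "\<lfloor>real k * \<theta> + cf_offset m\<rfloor> \<noteq> \<lfloor>real k * \<theta>\<rfloor>"
    using n(2) unfolding lower.hit_iff by (simp add: k_def algebra_simps)
  then consider "\<lfloor>real k * \<theta>\<rfloor> < \<lfloor>real k * \<theta> + cf_offset m\<rfloor>" | "\<lfloor>real k * \<theta> + cf_offset m\<rfloor> < \<lfloor>real k * \<theta>\<rfloor>"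
    by linarith
  then show False
  proof cases
    case 1
    define l where "l = \<lfloor>real k * \<theta> + cf_offset m\<rfloor>"
    have l: "real k * \<theta> < of_int l" "of_int l \<le> real k * \<theta> + cf_offset m"
      using 1 by (auto simp: l_def floor_less_iff)
    \<comment> \<open>The floor lets a step end exactly on an integer; this boundary case is left
      over and contradicts irrationality.\<close>
    then have "of_int l = real k * \<theta> + cf_offset m"
      using best_approximation[OF k, of l] abs_cf_offset[of m] by linarith
    then have "real (k + cf_denom m) * \<theta> = of_int (l + cf_num m)"
      by (simp add: cf_offset_def algebra_simps)
    then show False using multiple_slope_not_int[of "k + cf_denom m"] k by blast
  next
    case 2
    define l where "l = \<lfloor>real k * \<theta>\<rfloor>"
    have "real k * \<theta> + cf_offset m < of_int l" "of_int l \<le> real k * \<theta>"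
      using 2 by (auto simp: l_def floor_less_iff)
    then show False using best_approximation[OF k, of l] abs_cf_offset[of m] by linarith
  qed
qed

lemma agree_characteristic:
  assumes "1 \<le> m"
  shows "lower.agree \<theta> 0 (cf_denom m) (cf_denom (Suc m) - 1)"
  using first_hit_characteristic[OF assms]
  by (intro lower.agree_of_not_hit) (simp add: lower.first_hit_def)

text \<open>The lower cut of the limsup of \<open>cf_denom (Suc m) / cf_denom m\<close>, so that no
  value of the limsup has to be named.\<close>

definition frequent_ratios :: "real set" where
  "frequent_ratios = {x. \<forall>M. \<exists>m\<ge>M. x * real (cf_denom m) \<le> real (cf_denom (Suc m))}"

lemma frequent_ratiosD:
  assumes "x \<in> frequent_ratios"
  obtains m where "M \<le> m" "x * real (cf_denom m) \<le> real (cf_denom (Suc m))"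
  using assms unfolding frequent_ratios_def by blast

lemma one_frequent_ratio: "1 \<in> frequent_ratios"
  using cf_denom_le_Suc by (auto simp: frequent_ratios_def)

lemma not_frequent_ratioE:
  assumes "x \<notin> frequent_ratios"
  obtains M where "\<And>m. M \<le> m \<Longrightarrow> real (cf_denom (Suc m)) \<le> x * real (cf_denom m)"
proof -
  obtain M where "\<And>m. M \<le> m \<Longrightarrow> \<not> x * real (cf_denom m) \<le> real (cf_denom (Suc m))"
    using assms unfolding frequent_ratios_def by blast
  then show thesis by (intro that[of M]) (meson less_imp_le not_le)
qed

lemma characteristic_exponent_ge:
  assumes b: "2 \<le> b" and x: "0 \<le> x" "x \<in> frequent_ratios"
  shows "ereal (1 + x) \<le> irrationality_exponent (lower.number b 0 (b - 1) \<theta>)"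
proof (rule lower.exponent_ge_of_agree[OF b, where C = 1])
  fix K
  obtain m where m: "K + 1 \<le> m" "x * real (cf_denom m) \<le> real (cf_denom (Suc m))"
    using frequent_ratiosD[OF x(2)] by blast
  have "1 \<le> cf_denom m" "K \<le> cf_denom m" using cf_denom_pos[of m] cf_denom_ge[of m] m(1) by auto
  moreover have "x * real (0 + cf_denom m) - 1 \<le> real (cf_denom (Suc m) - 1)" using m(2) by simp
  ultimately show "\<exists>u v N. 1 \<le> v \<and> K \<le> u + v \<and> x * real (u + v) - 1 \<le> real N \<and> lower.agree \<theta> u v N"
    using agree_characteristic[of m] m(1)
    by (intro exI[of _ 0] exI[of _ "cf_denom m"] exI[of _ "cf_denom (Suc m) - 1"]) auto
qed (use b x in auto)

text \<open>At scale \<open>n\<close> between two denominators the prefix of period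
  \<open>cf_denom m\<close> serves. Its exact length \<open>cf_denom (Suc m) - 1\<close> and
  \<open>u = 0\<close> save one unit against the general bound.\<close>

lemma characteristic_exponent_le:
  assumes b: "2 \<le> b" and x: "1 \<le> x" "x \<notin> frequent_ratios"
  shows "irrationality_exponent (lower.number b 0 (b - 1) \<theta>) \<le> ereal (1 + x)"
proof -
  obtain M where M: "\<And>m. M \<le> m \<Longrightarrow> real (cf_denom (Suc m)) \<le> x * real (cf_denom m)"
    using not_frequent_ratioE[OF x(2)] by blast
  show ?thesis
  proof (rule lower.exponent_le_of_agree[OF b, where C = 0 and K = "cf_denom (Suc M)"])
    fix n assume n: "cf_denom (Suc M) \<le> n"
    then have n1: "1 \<le> n" using cf_denom_pos[of "Suc M"] by simp
    obtain m where m: "1 \<le> m" "cf_denom m \<le> n" "n < cf_denom (Suc m)"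
      using ex_cf_denom_bracket[OF n1] by blast
    have "M \<le> m"
    proof (rule ccontr)
      assume "\<not> ?thesis"
      then have "cf_denom (Suc m) \<le> cf_denom (Suc M)" by (intro cf_denom_mono) simp
      then show False using m n by linarith
    qed
    define N where "N = cf_denom (Suc m) - 1"
    have N: "1 \<le> N" "n \<le> N" using m n1 by (auto simp: N_def)
    have fh: "lower.first_hit \<theta> m N" using first_hit_characteristic[OF m(1)] by (simp add: N_def)
    then have "\<not> lower.hit \<theta> m 0" using N by (simp add: lower.first_hit_def)
    then have "lower.shift_diff \<theta> (cf_denom m) (0 + N) \<noteq> lower.shift_diff \<theta> (cf_denom m) 0"
      using fh lower.shift_diff_not_hit[of \<theta> m 0]
      by (simp add: lower.first_hit_def lower.hit_def lower.shift_diff_def)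
    moreover have "lower.agree \<theta> 0 (cf_denom m) N" using agree_characteristic[OF m(1)] by (simp add: N_def)
    moreover have "1 \<le> cf_denom m" using cf_denom_pos[of m] m by simp
    moreover have "real (0 + cf_denom m + N) \<le> (1 + x) * real n + 0"
    proof -
      have "real (0 + cf_denom m + N) \<le> real (cf_denom m) + real (cf_denom (Suc m))" by (simp add: N_def)
      also have "\<dots> \<le> (1 + x) * real (cf_denom m)" using M[OF \<open>M \<le> m\<close>] by (simp add: algebra_simps)
      also have "\<dots> \<le> (1 + x) * real n" using m x by (intro mult_left_mono) auto
      finally show ?thesis by simp
    qed
    ultimately show "\<exists>u v N. 1 \<le> v \<and> u + v \<le> Suc n \<and> n \<le> Suc N \<and> lower.agree \<theta> u v N \<and>
        lower.shift_diff \<theta> v (u + N) \<noteq> lower.shift_diff \<theta> v u \<and> real (u + v + N) \<le> (1 + x) * real n + 0"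
      using N m by (intro exI[of _ 0] exI[of _ "cf_denom m"] exI[of _ N]) auto
  qed (use b x in auto)
qed

section \<open>Nested intervals for the extremal intercept\<close>

lemma cf_error_small:
  assumes "0 < \<delta>"
  obtains M where "\<And>m. M \<le> m \<Longrightarrow> cf_error m < \<delta>"
proof -
  obtain M :: nat where M: "1 / \<delta> < real M" using reals_Archimedean2 by blast
  show thesis
  proof (rule that[of "Suc M"])
    fix m assume "Suc M \<le> m"
    then have "M \<le> cf_denom (Suc m)" using cf_denom_ge[of m] cf_denom_le_Suc[of m] by linarith
    then have q: "1 / \<delta> < real (cf_denom (Suc m))" using M by linarith
    have "0 < real (cf_denom (Suc m))" using cf_denom_pos[of "Suc m"] by simp
    then have "cf_error m \<le> 1 / real (cf_denom (Suc m))"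
      using cf_error_denom[of m] by (simp add: field_simps)
    also have "\<dots> < \<delta>" using q assms \<open>0 < real (cf_denom (Suc m))\<close> by (simp add: field_simps)
    finally show "cf_error m < \<delta>" .
  qed
qed

lemma dense_multiples:
  assumes "a < c"
  obtains j :: nat and l :: int where "1 \<le> j" "a < real j * \<theta> + of_int l" "real j * \<theta> + of_int l < c"
proof -
  obtain M where M: "\<And>m. M \<le> m \<Longrightarrow> cf_error m < c - a" using cf_error_small[of "c - a"] assms by auto
  \<comment> \<open>An odd index makes the offset positive; steps shorter than the interval cannot
    jump over it.\<close>
  define k where "k = 2 * M + 1"
  define e where "e = cf_error k"
  have e: "0 < e" "e < c - a" "cf_offset k = e"
    using cf_error_pos[of k] M[of k] cf_offset_eq[of k] by (auto simp: k_def e_def)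
  define l where "l = \<lfloor>a\<rfloor> - 1"
  define t where "t = nat \<lfloor>(a - of_int l) / e\<rfloor> + 1"
  have al: "0 < a - of_int l" unfolding l_def of_int_diff of_int_1 by linarith
  then have "0 \<le> \<lfloor>(a - of_int l) / e\<rfloor>" using e by simp
  then have "(a - of_int l) / e < real t" "real t \<le> (a - of_int l) / e + 1"
    unfolding t_def by (simp_all add: of_nat_nat) linarith+
  then have t: "a - of_int l < real t * e" "real t * e \<le> a - of_int l + e"
    using e by (simp_all add: field_simps)
  have eq: "real (t * cf_denom k) * \<theta> + of_int (l - int t * cf_num k) = real t * e + of_int l"
    unfolding e(3)[symmetric] cf_offset_def by (simp add: algebra_simps)
  show thesis
  proof (rule that[of "t * cf_denom k" "l - int t * cf_num k"])
    show "1 \<le> t * cf_denom k" using cf_denom_pos[of k] by (simp add: t_def k_def)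
    show "a < real (t * cf_denom k) * \<theta> + of_int (l - int t * cf_num k)"
      "real (t * cf_denom k) * \<theta> + of_int (l - int t * cf_num k) < c"
      unfolding eq using t e by linarith+
  qed
qed

text \<open>The requirement of stage \<open>i\<close>. The loss \<open>1 / real (Suc i)\<close>
  absorbs the delay \<open>j\<close> between the long gap's start and the intercept.\<close>

definition long_agreement :: "nat \<Rightarrow> real \<Rightarrow> real \<Rightarrow> bool" where
  "long_agreement i z \<rho> \<longleftrightarrow> (\<exists>m N. 1 \<le> cf_denom m \<and> i \<le> cf_denom m \<and>
     (1 + z - 1 / real (Suc i)) * real (cf_denom m) \<le> real N \<and> lower.agree \<rho> 0 (cf_denom m) N)"

text \<open>Pick \<open>x0 = j * \<theta> + l\<close> inside the interval. For an intercept suitably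
  close to \<open>x0\<close>, the point \<open>j\<close> steps earlier begins a long gap of index
  \<open>m\<close>, so the period lasts for the whole gap except those \<open>j\<close> steps. As
  \<open>j\<close> is fixed before \<open>m\<close>, the loss is negligible.\<close>

lemma ex_subinterval_long_agreement:
  assumes ac: "a < c" and z: "z \<in> frequent_ratios"
  obtains a' c' where "a < a'" "a' < c'" "c' < c" "\<And>\<rho>. a' \<le> \<rho> \<Longrightarrow> \<rho> \<le> c' \<Longrightarrow> long_agreement i z \<rho>"
proof -
  obtain j :: nat and l :: int where jl: "1 \<le> j" "a < real j * \<theta> + of_int l" "real j * \<theta> + of_int l < c"
    using dense_multiples[OF ac] by blast
  define x0 where "x0 = real j * \<theta> + of_int l"
  have "0 < min (x0 - a) (c - x0)" using jl by (simp add: x0_def)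
  then obtain M where M: "\<And>m. M \<le> m \<Longrightarrow> cf_error m < min (x0 - a) (c - x0)" using cf_error_small by blast
  obtain m where m: "M + Suc i * j + i + 2 \<le> m" "z * real (cf_denom m) \<le> real (cf_denom (Suc m))"
    using frequent_ratiosD[OF z] by blast
  have err: "cf_error m < x0 - a" "cf_error m < c - x0" using M[of m] m(1) by auto
  have q1: "Suc i * j \<le> cf_denom m" "i \<le> cf_denom m" "1 \<le> cf_denom m" using cf_denom_ge[of m] m(1) by linarith+
  have qless: "cf_denom m < cf_denom (Suc m)"
  proof -
    have "m = Suc (Suc (m - 2))" using m(1) by simp
    then show ?thesis using cf_denom_less_Suc[of "m - 2"] by metis
  qed
  define w where "w = cf_error (Suc m)"
  have w: "0 < w" "w < cf_error m" by (auto simp: w_def cf_error_pos cf_error_Suc_less)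
  \<comment> \<open>Start of the arc of length \<open>w\<close> on which the long gap begins; its
    middle third keeps all inequalities strict.\<close>
  define lo where "lo = (if cf_offset m > 0 then x0 - cf_error m else x0 + cf_error m - w)"
  show thesis
  proof (rule that[of "lo + w / 3" "lo + 2 * w / 3"])
    show "a < lo + w / 3" "lo + w / 3 < lo + 2 * w / 3" "lo + 2 * w / 3 < c"
      using err w by (auto simp: lo_def)
    fix \<rho> assume \<rho>: "lo + w / 3 \<le> \<rho>" "\<rho> \<le> lo + 2 * w / 3"
    define y where "y = \<rho> - real j * \<theta>"
    have y: "real j * \<theta> + y = \<rho>" by (simp add: y_def)
    have "lower.hit y m 0 \<and> lower.hit y (Suc m) (0 + cf_denom m)"
    proof (cases rule: cf_offset_cases[of m])
      case pos
      then have "y < of_int l" "of_int l \<le> y + cf_offset m" "y + cf_offset m + cf_offset (Suc m) < of_int l"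
        using \<rho> w by (auto simp: lo_def y_def x0_def w_def)
      then have "\<lfloor>y\<rfloor> < l" "l \<le> \<lfloor>y + cf_offset m\<rfloor>" "\<lfloor>y + cf_offset m + cf_offset (Suc m)\<rfloor> < l"
        by (simp_all add: floor_less_iff le_floor_iff)
      then show ?thesis unfolding lower.hit_iff[of _ _ 0] lower.hit_add_denom_iff by auto
    next
      case neg
      then have "of_int l \<le> y" "y + cf_offset m < of_int l" "of_int l \<le> y + cf_offset m + cf_offset (Suc m)"
        using \<rho> w by (auto simp: lo_def y_def x0_def w_def)
      then have "l \<le> \<lfloor>y\<rfloor>" "\<lfloor>y + cf_offset m\<rfloor> < l" "l \<le> \<lfloor>y + cf_offset m + cf_offset (Suc m)\<rfloor>"
        by (simp_all add: floor_less_iff le_floor_iff)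
      then show ?thesis unfolding lower.hit_iff[of _ _ 0] lower.hit_add_denom_iff by auto
    qed
    then have gap: "\<not> lower.hit y m (0 + k)" if "0 < k" "k < cf_denom m + cf_denom (Suc m)" for k
      using lower.hit_long_gap[of y m 0 k] qless that by blast
    define N where "N = cf_denom m + cf_denom (Suc m) - j"
    have "lower.agree \<rho> 0 (cf_denom m) N"
    proof (rule lower.agree_of_not_hit)
      fix n assume "n < N"
      then have "\<not> lower.hit y m (j + n)" using gap[of "j + n"] jl by (simp add: N_def)
      then show "\<not> lower.hit \<rho> m (0 + n)" by (simp add: lower.hit_add y)
    qed
    moreover have "(1 + z - 1 / real (Suc i)) * real (cf_denom m) \<le> real N"
    proof -
      have "real (Suc i * j) \<le> real (cf_denom m)" using q1(1) by (simp only: of_nat_le_iff)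
      then have "real j \<le> real (cf_denom m) / real (Suc i)" by (simp add: field_simps)
      moreover have "real (cf_denom m) + real (cf_denom (Suc m)) - real j \<le> real N" by (simp add: N_def)
      moreover have "(1 + z - 1 / real (Suc i)) * real (cf_denom m)
          = real (cf_denom m) + z * real (cf_denom m) - real (cf_denom m) / real (Suc i)"
        by (simp add: field_simps)
      ultimately show ?thesis using m(2) by linarith
    qed
    ultimately show "long_agreement i z \<rho>" unfolding long_agreement_def using q1 by blast
  qed
qed

text \<open>One sequence that approaches the supremum, finite or not, so that a single intercept can
  serve every ratio \<open>w\<close>.\<close>

lemma approach_frequent_ratios:
  "\<exists>z :: nat \<Rightarrow> real. (\<forall>i. z i \<in> frequent_ratios) \<and>
    (\<forall>w\<in>frequent_ratios. \<forall>\<eta>>0. \<exists>I. \<forall>i\<ge>I. w - \<eta> < z i)"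
proof (cases "bdd_above frequent_ratios")
  case True
  have ne: "frequent_ratios \<noteq> {}" using one_frequent_ratio by blast
  define s where "s = Sup frequent_ratios"
  have "\<exists>z\<in>frequent_ratios. s - 1 / real (Suc i) < z" for i
    using less_cSupE[of "s - 1 / real (Suc i)" frequent_ratios] ne by (auto simp: s_def)
  then obtain z where z: "\<And>i. z i \<in> frequent_ratios" "\<And>i. s - 1 / real (Suc i) < z i" by metis
  show ?thesis
  proof (intro exI[of _ z] conjI; safe)
    fix w \<eta> :: real assume w: "w \<in> frequent_ratios" "0 < \<eta>"
    have "w \<le> s" unfolding s_def using w(1) True by (rule cSup_upper)
    obtain I :: nat where I: "1 / real (Suc I) < \<eta>" using w(2) by (metis inverse_eq_divide reals_Archimedean)
    have "w - \<eta> < z i" if "I \<le> i" for i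
    proof -
      have "1 / real (Suc i) \<le> 1 / real (Suc I)" using that by (intro divide_left_mono) auto
      then show ?thesis using z(2)[of i] I \<open>w \<le> s\<close> by linarith
    qed
    then show "\<exists>I. \<forall>i\<ge>I. w - \<eta> < z i" by blast
  qed (use z in blast)
next
  case False
  then have "\<exists>z\<in>frequent_ratios. real i < z" for i
    unfolding bdd_above_def by (meson not_le)
  then obtain z where z: "\<And>i. z i \<in> frequent_ratios" "\<And>i. real i < z i" by metis
  show ?thesis
  proof (intro exI[of _ z] conjI; safe)
    fix w \<eta> :: real assume w: "w \<in> frequent_ratios" "0 < \<eta>"
    obtain I :: nat where "w < real I" using reals_Archimedean2 by blast
    then have "w - \<eta> < z i" if "I \<le> i" for i
      using z(2)[of i] w(2) of_nat_mono[OF that, where 'a = real] by linarith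
    then show "\<exists>I. \<forall>i\<ge>I. w - \<eta> < z i" by blast
  qed (use z in blast)
qed

text \<open>The nested intervals constrain the word alone, so the same intercept works in every
  base.\<close>

lemma ex_extremal_intercept:
  obtains \<rho> where "0 \<le> \<rho>" "\<rho> < 1"
    "\<And>b w. 2 \<le> b \<Longrightarrow> 0 \<le> w \<Longrightarrow> w \<in> frequent_ratios \<Longrightarrow>
       ereal (2 + w) \<le> irrationality_exponent (lower.number b 0 (b - 1) \<rho>)"
proof -
  obtain z :: "nat \<Rightarrow> real" where z: "\<forall>i. z i \<in> frequent_ratios"
    "\<forall>w\<in>frequent_ratios. \<forall>\<eta>>0. \<exists>I. \<forall>i\<ge>I. w - \<eta> < z i"
    using approach_frequent_ratios by blast
  define P where "P = (\<lambda>(n::nat) (x::real \<times> real). 0 \<le> fst x \<and> fst x < snd x \<and> snd x \<le> 1)"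
  \<comment> \<open>Both endpoints move strictly, which places the common point below 1.\<close>
  define R where "R = (\<lambda>(i::nat) (x::real \<times> real) (y::real \<times> real). fst x < fst y \<and> snd y < snd x \<and>
    (\<forall>\<rho>. fst y \<le> \<rho> \<longrightarrow> \<rho> \<le> snd y \<longrightarrow> long_agreement i (z i) \<rho>))"
  have "\<exists>f. \<forall>n. P n (f n) \<and> R n (f n) (f (Suc n))"
  proof (rule dependent_nat_choice)
    show "\<exists>x. P 0 x" by (intro exI[of _ "(0, 1)"]) (simp add: P_def)
    fix x i assume x: "P i x"
    then obtain a' c' where "fst x < a'" "a' < c'" "c' < snd x"
      "\<And>\<rho>. a' \<le> \<rho> \<Longrightarrow> \<rho> \<le> c' \<Longrightarrow> long_agreement i (z i) \<rho>"
      using ex_subinterval_long_agreement[of "fst x" "snd x" "z i" i] z(1) unfolding P_def by blast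
    then show "\<exists>y. P (Suc i) y \<and> R i x y"
      using x by (intro exI[of _ "(a', c')"]) (auto simp: P_def R_def)
  qed
  then obtain f where f: "\<And>n. P n (f n)" "\<And>n. R n (f n) (f (Suc n))" by blast
  define lo hi where "lo n = fst (f n)" and "hi n = snd (f n)" for n
  have "incseq lo" using f(2) by (intro incseq_SucI) (auto simp: lo_def R_def intro: less_imp_le)
  moreover have "decseq hi" using f(2) by (intro decseq_SucI) (auto simp: hi_def R_def intro: less_imp_le)
  ultimately have cross: "lo i \<le> hi n" for i n
  proof -
    have "lo i \<le> lo (max i n)" using \<open>incseq lo\<close> by (simp add: incseqD)
    also have "\<dots> \<le> hi (max i n)" using f(1)[of "max i n"] by (simp add: P_def lo_def hi_def)
    also have "\<dots> \<le> hi n" using \<open>decseq hi\<close> by (simp add: decseqD)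
    finally show ?thesis .
  qed
  define \<rho> where "\<rho> = Sup (range lo)"
  have "bdd_above (range lo)" using cross[of _ 0] by (auto simp: bdd_above_def)
  then have ge: "lo n \<le> \<rho>" for n unfolding \<rho>_def by (intro cSup_upper) auto
  have le: "\<rho> \<le> hi n" for n unfolding \<rho>_def using cross by (intro cSup_least) auto
  have long: "long_agreement i (z i) \<rho>" for i
    using f(2)[of i] ge[of "Suc i"] le[of "Suc i"] by (auto simp: R_def lo_def hi_def)
  show thesis
  proof (rule that[of \<rho>])
    show "0 \<le> \<rho>" using ge[of 0] f(1)[of 0] by (simp add: P_def lo_def)
    show "\<rho> < 1" using le[of 1] f(2)[of 0] f(1)[of 0] by (simp add: P_def R_def hi_def)
    fix b :: nat and w :: real
    assume b: "2 \<le> b" and w: "0 \<le> w" "w \<in> frequent_ratios"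
    have key: "ereal (1 + (1 + w - \<eta>)) \<le> irrationality_exponent (lower.number b 0 (b - 1) \<rho>)"
      if \<eta>: "0 < \<eta>" "\<eta> < 1" for \<eta>
    proof (rule lower.exponent_ge_of_agree[OF b, where C = 0])
      fix K :: nat
      obtain I where I: "\<forall>i\<ge>I. w - \<eta> / 2 < z i" using z(2)[rule_format, OF w(2), of "\<eta> / 2"] \<eta> by auto
      obtain J :: nat where J: "1 / real (Suc J) < \<eta> / 2"
        using \<eta> by (metis half_gt_zero inverse_eq_divide reals_Archimedean)
      define i where "i = max K (max I J)"
      have "1 / real (Suc i) \<le> 1 / real (Suc J)" by (intro divide_left_mono) (auto simp: i_def)
      moreover have "w - \<eta> / 2 < z i" using I by (simp add: i_def)
      ultimately have zi: "1 + w - \<eta> \<le> 1 + z i - 1 / real (Suc i)" using J by linarith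
      obtain m N where mN: "1 \<le> cf_denom m" "i \<le> cf_denom m"
        "(1 + z i - 1 / real (Suc i)) * real (cf_denom m) \<le> real N" "lower.agree \<rho> 0 (cf_denom m) N"
        using long[of i] unfolding long_agreement_def by blast
      have "(1 + w - \<eta>) * real (cf_denom m) \<le> (1 + z i - 1 / real (Suc i)) * real (cf_denom m)"
        using zi by (intro mult_right_mono) auto
      then have "(1 + w - \<eta>) * real (cf_denom m) \<le> real N" using mN(3) by linarith
      moreover have "K \<le> cf_denom m" using mN(2) by (simp add: i_def)
      ultimately show "\<exists>u v N. 1 \<le> v \<and> K \<le> u + v \<and> (1 + w - \<eta>) * real (u + v) - 0 \<le> real N \<and>
          lower.agree \<rho> u v N"
        using mN(1,4) by (intro exI[of _ 0] exI[of _ "cf_denom m"] exI[of _ N]) simp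
    qed (use b w \<eta> in auto)
    show "ereal (2 + w) \<le> irrationality_exponent (lower.number b 0 (b - 1) \<rho>)"
    proof (rule dense_le)
      fix y assume y: "y < ereal (2 + w)"
      show "y \<le> irrationality_exponent (lower.number b 0 (b - 1) \<rho>)"
      proof (cases y)
        case (real r)
        define \<eta> where "\<eta> = min (2 + w - r) (1 / 2)"
        have "0 < \<eta>" "\<eta> < 1" using y real by (auto simp: \<eta>_def)
        then have "ereal (1 + (1 + w - \<eta>)) \<le> irrationality_exponent (lower.number b 0 (b - 1) \<rho>)" by (rule key)
        moreover have "y \<le> ereal (1 + (1 + w - \<eta>))" unfolding real by (simp add: \<eta>_def)
        ultimately show ?thesis by (rule order_trans[rotated])
      qed (use y in auto)
    qed
  qed
qed

section \<open>The series in the statement as Sturmian numbers\<close>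

lemma lower_sturmian_level: "lower_sturmian \<theta> \<rho> (Suc n) = lower.level \<rho> (Suc n) - lower.level \<rho> n"
  by (simp add: lower_sturmian_def lower.level_def)

lemma xi_intercept_eq: "2 \<le> b \<Longrightarrow> xi_intercept b \<theta> \<rho> = lower.number b 0 (b - 1) \<rho>"
proof -
  assume b: "2 \<le> b"
  define s where "s n = lower.level \<rho> (Suc n) - lower.level \<rho> n" for n
  have s: "s n = 0 \<or> s n = 1" for n unfolding s_def by (rule lower.level_Suc)
  have "summable (\<lambda>n. (of_int (s n) / real b) / real b ^ n)"
  proof (rule digit_series_bounds(1))
    show "0 \<le> of_int (s k) / real b" "of_int (s k) / real b \<le> 1" for k using s[of k] b by auto
  qed (use b in simp)
  then have "summable (\<lambda>n. of_int (s n) / real b ^ Suc n)" by simp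
  then have "(\<Sum>n. (real b - 1) * (of_int (s n) / real b ^ Suc n)) = xi_intercept b \<theta> \<rho>"
    unfolding xi_intercept_def lower_sturmian_level s_def[symmetric] by (rule suminf_mult)
  moreover have "(real b - 1) * (of_int (s n) / real b ^ Suc n) = real (if s n = 0 then 0 else b - 1) / real b ^ Suc n" for n
    using s[of n] b by (auto simp: of_nat_diff)
  ultimately show ?thesis by (simp only: lower.number_def s_def[symmetric])
qed

text \<open>In the word of intercept \<open>\<theta>\<close> a 1 at position \<open>n\<close> means
  that some integer \<open>j\<close> lies between \<open>n * \<theta>\<close> and
  \<open>(n + 1) * \<theta>\<close>. By irrationality this says that \<open>n\<close> is the floor
  of \<open>j / \<theta>\<close>.\<close>

lemma xi_eq: "xi b \<theta> = xi_intercept b \<theta> \<theta>"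
proof -
  define f :: "nat \<Rightarrow> real" where "f n = of_int (lower_sturmian \<theta> \<theta> (Suc n)) / real b ^ Suc n" for n
  define F where "F j = \<lfloor>real (Suc j) / \<theta>\<rfloor>" for j :: nat
  \<comment> \<open>Positions count from 1 and series indices from 0.\<close>
  define G where "G j = nat (F j - 1)" for j
  have F1: "1 \<le> F j" for j
  proof -
    have "1 \<le> real (Suc j) / \<theta>" using slope_pos slope_less_1 by (simp add: pos_le_divide_eq)
    then show ?thesis unfolding F_def by linarith
  qed
  have GF: "int (Suc (G j)) = F j" for j using F1[of j] by (simp add: G_def)
  have Fmono: "F j < F (Suc j)" for j
  proof -
    have "real (Suc j) / \<theta> + 1 \<le> real (Suc (Suc j)) / \<theta>"
      using slope_pos slope_less_1 by (simp add: field_simps)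
    then show ?thesis unfolding F_def by linarith
  qed
  have "strict_mono G"
    unfolding strict_mono_Suc_iff
  proof
    fix j
    show "G j < G (Suc j)" using Fmono[of j] F1[of j] by (simp add: G_def)
  qed
  moreover have "f n = 0" if "n \<notin> range G" for n
  proof (rule ccontr)
    assume "f n \<noteq> 0"
    then have "lower_sturmian \<theta> \<theta> (Suc n) \<noteq> 0" by (auto simp: f_def)
    then have "lower.level \<theta> (Suc n) - lower.level \<theta> n = 1"
      using lower.level_Suc[of \<theta> n] unfolding lower_sturmian_level by blast
    then have lev: "\<lfloor>real (Suc (Suc n)) * \<theta>\<rfloor> - \<lfloor>real (Suc n) * \<theta>\<rfloor> = 1"
      by (simp add: lower.level_def algebra_simps)
    define j where "j = \<lfloor>real (Suc (Suc n)) * \<theta>\<rfloor>"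
    have "0 \<le> \<lfloor>real (Suc n) * \<theta>\<rfloor>" using slope_pos by simp
    then have j1: "1 \<le> j" using lev unfolding j_def by linarith
    have jn: "of_int j \<le> real (Suc (Suc n)) * \<theta>" "real (Suc n) * \<theta> < of_int j"
      using lev unfolding j_def by linarith+
    moreover have "real (Suc (Suc n)) * \<theta> \<noteq> of_int j" by (rule multiple_slope_not_int) simp
    ultimately have "of_int j / \<theta> < real (Suc (Suc n))" "real (Suc n) < of_int j / \<theta>"
      using slope_pos by (simp_all add: pos_divide_less_eq pos_less_divide_eq)
    moreover have "real (Suc (nat (j - 1))) = of_int j" using j1 by simp
    ultimately have "F (nat (j - 1)) = int (Suc n)" unfolding F_def by (intro floor_unique) auto
    then have "G (nat (j - 1)) = n" by (simp add: G_def)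
    then show False using that by blast
  qed
  ultimately have "(\<Sum>j. f (G j)) = (\<Sum>n. f n)" by (rule suminf_mono_reindex)
  moreover have "f (G j) = real b powi (- F j)" for j
  proof -
    define N where "N = Suc (G j)"
    have N: "int N = F j" using GF by (simp add: N_def)
    have "of_int (F j) \<le> real (Suc j) / \<theta>" "real (Suc j) / \<theta> < of_int (F j) + 1"
      unfolding F_def by linarith+
    then have "real N * \<theta> \<le> real (Suc j)" "real (Suc j) < (real N + 1) * \<theta>"
      using slope_pos unfolding N[symmetric] by (simp_all add: pos_le_divide_eq pos_divide_less_eq)
    moreover have "real N * \<theta> \<noteq> of_int (int (Suc j))" by (rule multiple_slope_not_int) (simp add: N_def)
    ultimately have lt: "real N * \<theta> < real (Suc j)" "real (Suc j) < real N * \<theta> + \<theta>"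
      by (auto simp: algebra_simps)
    have "\<lfloor>real N * \<theta>\<rfloor> = int j" using lt slope_less_1 by (intro floor_unique) auto
    moreover have "\<lfloor>real N * \<theta> + \<theta>\<rfloor> = int (Suc j)" using lt slope_less_1 by (intro floor_unique) auto
    ultimately have "lower_sturmian \<theta> \<theta> (Suc (G j)) = 1"
      unfolding lower_sturmian_def N_def[symmetric] by (simp add: N_def algebra_simps)
    then have "f (G j) = 1 / real b ^ N" by (simp add: f_def N_def)
    also have "\<dots> = real b powi (- int N)" by (simp add: power_int_minus divide_inverse)
    finally show ?thesis unfolding N .
  qed
  ultimately show ?thesis by (simp add: xi_def xi_intercept_def f_def F_def)
qed

lemma xi_number: "2 \<le> b \<Longrightarrow> xi b \<theta> = lower.number b 0 (b - 1) \<theta>"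
  by (simp add: xi_eq xi_intercept_eq)

lemma two_le_xi_exponent: "2 \<le> b \<Longrightarrow> ereal 2 \<le> irrationality_exponent (xi b \<theta>)"
  using characteristic_exponent_ge[of b 1] one_frequent_ratio by (simp add: xi_number)

text \<open>This lemma and \<open>one_plus_xi_exponent_le\<close> translate the cut
  \<open>frequent_ratios\<close> into the exponent of \<open>xi\<close>, including the value
  infinity.\<close>

lemma le_one_plus_xi_exponent:
  assumes b: "2 \<le> b"
    and le: "\<And>x. 0 \<le> x \<Longrightarrow> x \<notin> frequent_ratios \<Longrightarrow> \<mu> \<le> ereal (2 + x)"
  shows "\<mu> \<le> 1 + irrationality_exponent (xi b \<theta>)"
proof (rule dense_ge)
  fix y assume y: "1 + irrationality_exponent (xi b \<theta>) < y"
  show "\<mu> \<le> y"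
  proof (cases y)
    case (real r)
    have less: "irrationality_exponent (xi b \<theta>) < ereal (1 + (r - 2))"
      using y real by (cases "irrationality_exponent (xi b \<theta>)") auto
    then have "ereal 2 < ereal (1 + (r - 2))" using two_le_xi_exponent[OF b] by (rule le_less_trans[rotated])
    then have r: "0 \<le> r - 2" by simp
    have "r - 2 \<notin> frequent_ratios"
      using characteristic_exponent_ge[OF b r] less by (auto simp: xi_number[OF b])
    then have "\<mu> \<le> ereal (2 + (r - 2))" using r by (intro le)
    then show ?thesis by (simp add: real)
  qed (use y in auto)
qed

lemma one_plus_xi_exponent_le:
  assumes b: "2 \<le> b"
    and le: "\<And>x. 0 \<le> x \<Longrightarrow> x \<in> frequent_ratios \<Longrightarrow> ereal (2 + x) \<le> \<mu>"
  shows "1 + irrationality_exponent (xi b \<theta>) \<le> \<mu>"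
proof (rule dense_le)
  fix y assume y: "y < 1 + irrationality_exponent (xi b \<theta>)"
  show "y \<le> \<mu>"
  proof (cases y)
    case (real r)
    \<comment> \<open>Since 1 is a frequent ratio, a failure of membership can only come from
      \<open>r - 2\<close>, and \<open>characteristic_exponent_le\<close> needs \<open>x\<close> to
      be at least 1.\<close>
    define x where "x = max 1 (r - 2)"
    have "x \<in> frequent_ratios"
    proof (rule ccontr)
      assume x: "x \<notin> frequent_ratios"
      then have "x = r - 2" using one_frequent_ratio by (auto simp: x_def max_def split: if_splits)
      moreover have "irrationality_exponent (xi b \<theta>) \<le> ereal (1 + x)"
        using characteristic_exponent_le[OF b _ x] by (simp add: x_def xi_number[OF b])
      ultimately show False
        using y real by (cases "irrationality_exponent (xi b \<theta>)") auto
    qed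
    then have "ereal (2 + x) \<le> \<mu>" by (intro le) (auto simp: x_def)
    moreover have "y \<le> ereal (2 + x)" by (simp add: real x_def)
    ultimately show ?thesis by (rule order_trans[rotated])
  qed (use y in auto)
qed

section \<open>Upper words and passage to all Sturmian numbers\<close>

interpretation upper: sturmian_coding \<theta> "ceiling :: real \<Rightarrow> int"
  by unfold_locales (auto intro: monoI ceiling_mono)

lemma upper_sturmian_level: "upper_sturmian \<theta> \<rho> (Suc n) = upper.level \<rho> (Suc n) - upper.level \<rho> n"
  by (simp add: upper_sturmian_def upper.level_def)

lemma sturmian_numberE:
  assumes "is_sturmian_number \<theta> \<zeta>"
  obtains b d0 d1 \<rho> where "2 \<le> b" "d0 < b" "d1 < b" "d0 \<noteq> d1"
    "\<zeta> = lower.number b d0 d1 \<rho> \<or> \<zeta> = upper.number b d0 d1 \<rho>"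
proof -
  obtain b d0 d1 s where s: "2 \<le> b" "d0 < b" "d1 < b" "d0 \<noteq> d1" "is_sturmian_word \<theta> s"
    "\<zeta> = (\<Sum>n. real (if s (Suc n) = 0 then d0 else d1) / real b ^ Suc n)"
    using assms unfolding is_sturmian_number_def by blast
  obtain \<rho> where "s = lower_sturmian \<theta> \<rho> \<or> s = upper_sturmian \<theta> \<rho>"
    using s(5) unfolding is_sturmian_word_def by blast
  then have "\<zeta> = lower.number b d0 d1 \<rho> \<or> \<zeta> = upper.number b d0 d1 \<rho>"
    unfolding s(6) lower.number_def upper.number_def lower_sturmian_level[symmetric] upper_sturmian_level[symmetric]
    by auto
  then show thesis using that s by blast
qed

lemma sturmian_number_exponent_ge:
  assumes "is_sturmian_number \<theta> \<zeta>"
  shows "ereal (5 / 3 + 4 * sqrt 10 / 15) \<le> irrationality_exponent \<zeta>"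
  using assms
  by (rule sturmian_numberE) (auto intro: lower.sturmian_exponent_ge upper.sturmian_exponent_ge)

lemma sturmian_number_exponent_le:
  assumes "is_sturmian_number \<theta> \<zeta>" "2 \<le> b"
  shows "irrationality_exponent \<zeta> \<le> 1 + irrationality_exponent (xi b \<theta>)"
proof (rule le_one_plus_xi_exponent[OF assms(2)])
  fix x :: real assume x: "0 \<le> x" "x \<notin> frequent_ratios"
  obtain M where "\<And>m. M \<le> m \<Longrightarrow> real (cf_denom (Suc m)) \<le> x * real (cf_denom m)"
    using not_frequent_ratioE[OF x(2)] by blast
  then show "irrationality_exponent \<zeta> \<le> ereal (2 + x)"
    using assms(1) x(1)
    by (elim sturmian_numberE) (auto intro!: lower.sturmian_exponent_le upper.sturmian_exponent_le)
qed

lemma is_sturmian_number_xi_intercept: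
  assumes "2 \<le> b" "0 \<le> \<rho>" "\<rho> < 1"
  shows "is_sturmian_number \<theta> (xi_intercept b \<theta> \<rho>)"
  unfolding is_sturmian_number_def xi_intercept_eq[OF assms(1)]
proof (intro exI conjI)
  show "is_sturmian_word \<theta> (lower_sturmian \<theta> \<rho>)" using assms by (auto simp: is_sturmian_word_def)
  show "lower.number b 0 (b - 1) \<rho> =
      (\<Sum>n. real (if lower_sturmian \<theta> \<rho> (Suc n) = 0 then 0 else b - 1) / real b ^ Suc n)"
    by (simp only: lower.number_def lower_sturmian_level)
qed (use assms in auto)

lemma ex_intercept_exponent:
  obtains \<rho> where "0 \<le> \<rho>" "\<rho> < 1"
    "\<And>b. 2 \<le> b \<Longrightarrow> irrationality_exponent (xi_intercept b \<theta> \<rho>) = 1 + irrationality_exponent (xi b \<theta>)"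
proof -
  obtain \<rho> where \<rho>: "0 \<le> \<rho>" "\<rho> < 1"
    "\<And>b w. 2 \<le> b \<Longrightarrow> 0 \<le> w \<Longrightarrow> w \<in> frequent_ratios \<Longrightarrow>
       ereal (2 + w) \<le> irrationality_exponent (lower.number b 0 (b - 1) \<rho>)"
    using ex_extremal_intercept by blast
  show thesis
  proof (rule that[OF \<rho>(1,2)])
    fix b :: nat assume b: "2 \<le> b"
    show "irrationality_exponent (xi_intercept b \<theta> \<rho>) = 1 + irrationality_exponent (xi b \<theta>)"
    proof (rule antisym)
      show "irrationality_exponent (xi_intercept b \<theta> \<rho>) \<le> 1 + irrationality_exponent (xi b \<theta>)"
        using is_sturmian_number_xi_intercept[OF b \<rho>(1,2)] b by (rule sturmian_number_exponent_le)
      show "1 + irrationality_exponent (xi b \<theta>) \<le> irrationality_exponent (xi_intercept b \<theta> \<rho>)"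
        unfolding xi_intercept_eq[OF b] by (rule one_plus_xi_exponent_le[OF b]) (rule \<rho>(3)[OF b])
    qed
  qed
qed

end

theorem theorem2p6:
  fixes \<theta> :: real
  assumes "0 < \<theta>" and "\<theta> < 1" and "\<theta> \<notin> \<rat>"
    and "bounded_partial_quotients \<theta>"
  shows "(\<forall>b::nat. b \<ge> 2 \<longrightarrow>
            sturmian_exponents \<theta>
              \<subseteq> {ereal (5 / 3 + 4 * sqrt 10 / 15) .. 1 + irrationality_exponent (xi b \<theta>)}) \<and>
         (\<exists>\<rho>. 0 \<le> \<rho> \<and> \<rho> < 1 \<and>
            (\<forall>b::nat. b \<ge> 2 \<longrightarrow>
               irrationality_exponent (xi_intercept b \<theta> \<rho>)
                 = 1 + irrationality_exponent (xi b \<theta>)))"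
proof -
  interpret irrational_slope \<theta> using assms by unfold_locales
  have "irrationality_exponent \<zeta> \<in> {ereal (5 / 3 + 4 * sqrt 10 / 15) .. 1 + irrationality_exponent (xi b \<theta>)}"
    if "is_sturmian_number \<theta> \<zeta>" "2 \<le> b" for \<zeta> b
    using sturmian_number_exponent_ge[OF that(1)] sturmian_number_exponent_le[OF that] by simp
  moreover obtain \<rho> where "0 \<le> \<rho>" "\<rho> < 1"
    "\<And>b. 2 \<le> b \<Longrightarrow> irrationality_exponent (xi_intercept b \<theta> \<rho>) = 1 + irrationality_exponent (xi b \<theta>)"
    using ex_intercept_exponent by blast
  ultimately show ?thesis unfolding sturmian_exponents_def by blast
qed

end
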